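(* Let $k<n$ be positive integers. The set $\{\pi\in\mathfrak{S}_n:\mathrm{inv}(\pi)=k\}$ of permutations in $\mathfrak{S}_n$ with exactly $k$ inversions, equipped with the usual descent map $\mathrm{Des}$, has a cyclic descent extension if and only if $k$ is not a generalized pentagonal number.
   Context: $[m]=\{1,\dots,m\}$; $\mathfrak{S}_n$ is the symmetric group on $[n]$. $\mathrm{inv}(\pi)$ is the number of pairs $i<j$ with $\pi(i)>\pi(j)$, and $\mathrm{Des}(\pi)=\{1\le i\le n-1:\pi(i)>\pi(i+1)\}$. A positive integer $k$ is a generalized pentagonal number if $k=\frac{(3m+1)m}{2}$ or $k=\frac{(3m-1)m}{2}$ for some positive integer $m$. Cyclic descent extension: let $\mathcal{T}$ be a finite set with a map $\mathrm{Des}:\mathcal{T}\to2^{[n-1]}$. Let $\mathrm{sh}:2^{[n]}\to2^{[n]}$ be the cyclic shift, $\mathrm{sh}(P)=\{i+1 \bmod n: i\in P\}$ (with representatives in $[n]$). A cyclic descent extension on $\mathcal{T}$ is a pair $(\mathrm{cDes},p)$ with $\mathrm{cDes}:\mathcal{T}\to2^{[n]}$ a map and $p:\mathcal{T}\to\mathcal{T}$ a bijection such that for all $T\in\mathcal{T}$: (extension) $\mathrm{cDes}(T)\cap[n-1]=\mathrm{Des}(T)$; (equivariance) $\mathrm{cDes}(p(T))=\mathrm{sh}(\mathrm{cDes}(T))$; (non-Escher) $\emptyset\subsetneq\mathrm{cDes}(T)\subsetneq[n]$. *)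

theory Defs
  imports "HOL-Combinatorics.Permutations" "HOL-Library.FuncSet"
begin

definition inv_number :: "nat \<Rightarrow> (nat \<Rightarrow> nat) \<Rightarrow> nat" where
  "inv_number n \<pi> = card {(i, j). i \<in> {1..n} \<and> j \<in> {1..n} \<and> i < j \<and> \<pi> i > \<pi> j}"

definition Des :: "nat \<Rightarrow> (nat \<Rightarrow> nat) \<Rightarrow> nat set" where
  "Des n \<pi> = {i \<in> {1..n - 1}. \<pi> i > \<pi> (i + 1)}"

definition perms_with_inv :: "nat \<Rightarrow> nat \<Rightarrow> (nat \<Rightarrow> nat) set" where
  "perms_with_inv n k = {\<pi>. \<pi> permutes {1..n} \<and> inv_number n \<pi> = k}"

(* i + 1 modulo n with representatives 1..n: for i in {1..n} this is i mod n + 1, so n goes to 1. *)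
definition cyc_shift :: "nat \<Rightarrow> nat set \<Rightarrow> nat set" where
  "cyc_shift n P = (\<lambda>i. i mod n + 1) ` P"

(* The values of cDes and p outside T are irrelevant.  It is meant for finite T and a map D
   sending T into the subsets of {1..n - 1}. *)
definition cyclic_descent_extension ::
  "nat \<Rightarrow> 'a set \<Rightarrow> ('a \<Rightarrow> nat set) \<Rightarrow> ('a \<Rightarrow> nat set) \<Rightarrow> ('a \<Rightarrow> 'a) \<Rightarrow> bool" where
  "cyclic_descent_extension n T D cDes p \<longleftrightarrow>
     cDes \<in> T \<rightarrow> Pow {1..n} \<and>
     bij_betw p T T \<and>
     (\<forall>t\<in>T. cDes t \<inter> {1..n - 1} = D t) \<and>
     (\<forall>t\<in>T. cDes (p t) = cyc_shift n (cDes t)) \<and>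
     (\<forall>t\<in>T. {} \<subset> cDes t \<and> cDes t \<subset> {1..n})"

(* Both products are even and m >= 1, so neither div nor the subtraction truncates. *)
definition generalized_pentagonal :: "nat \<Rightarrow> bool" where
  "generalized_pentagonal k \<longleftrightarrow>
     (\<exists>m\<ge>1. k = (3 * m + 1) * m div 2 \<or> k = (3 * m - 1) * m div 2)"

end

theory Submission
  imports Defs "HOL-Combinatorics.Multiset_Permutations"
begin

text \<open>Write \<open>m D\<close> for the number of permutations of \<open>{1..n}\<close> with \<open>k\<close> inversions and descent set \<open>D\<close>.
A cyclic descent extension is the same thing as a function \<open>N\<close> on the subsets of \<open>{1..n}\<close> with values in the
natural numbers that is invariant under the cyclic shift, vanishes at the empty set and at \<open>{1..n}\<close>, and
satisfies \<open>N D + N (insert n D) = m D\<close> for all \<open>D \<subseteq> {1..n - 1}\<close>: such an \<open>N\<close> gives the sizes of the fibres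
of \<open>cDes\<close>, and fibres of these sizes can be chosen and then permuted along the shift
(\<open>cyclic_fibre_counts_of_extension\<close>, \<open>extension_of_cyclic_fibre_counts\<close>).

The equations leave no freedom. Encode a subset as a word of length \<open>n\<close> over \<open>{F, T}\<close>, with \<open>T\<close> at its
elements. Rotating \<open>P T F^c\<close> until its last \<open>T\<close> stands at the end gives
\<open>N (P T F^c) = m (F^c P) - N (P F^(c + 1))\<close>, and together with \<open>N (F^n) = 0\<close> this determines \<open>N\<close> by
recursion on the number of \<open>T\<close>s. The integer-valued solution \<open>cyc_count\<close> of this recursion always exists.
It remains to see when it is rotation invariant, nonnegative, and zero at \<open>T^n\<close>.

Rotation invariance always holds (\<open>cyc_count_rotate\<close>). It rests on an identity between numbers of
permutations (\<open>desc_count_rotate\<close>) that becomes visible when permutations are built by inserting entries one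
after another at the front, or equally at the back: the inserted entries can be described by the same
sequences of numbers in both cases.

At the words \<open>T^t F^(n - t)\<close> the recursion involves only the hook-shaped descent words \<open>F^a T^b\<close>. Because
\<open>k < n\<close>, the permutations with such a descent word and \<open>k\<close> inversions correspond to the partitions of \<open>k\<close> into
\<open>b\<close> distinct parts (\<open>desc_count_hook\<close>), so the values are the alternating partial sums of the numbers of these
partitions. Franklin's involution from the proof of Euler's pentagonal number theorem pairs partitions whose
numbers of parts differ by one, and leaves over only the staircases, whose sums are the generalized pentagonal
numbers. If \<open>k\<close> is not one of them, each partial sum counts the pairs that straddle \<open>t\<close>; hence it is
nonnegative, and it is zero for \<open>t = n\<close> (\<open>cyc_count_gathered\<close>). If \<open>k\<close> is one of them, exactly one partition is left
over, the value forced at \<open>T^n\<close> is \<open>1\<close> or \<open>-1\<close>, and no extension exists (\<open>recurrence_nonzero_if_pentagonal\<close>).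

The other words are compared with \<open>T^t F^(n - t)\<close>, \<open>t\<close> being the number of \<open>T\<close>s. After a rotation a longest run
of \<open>F\<close>s stands at the end, and then every other \<open>F\<close> can be moved to this run, one at a time. Such a move does
not increase \<open>cyc_count\<close> (\<open>cyc_count_exchange\<close>): the difference is a difference of two numbers of
permutations, which the insertion of entries reduces to an inequality between first and last entries
(\<open>card_above_last_le_hd\<close>), proved by an injection that needs \<open>k < n\<close>. So \<open>cyc_count\<close> is nonnegative everywhere
if it is nonnegative at the words \<open>T^t F^(n - t)\<close> (\<open>cyc_count_ge_gathered\<close>).\<close>

section \<open>Permutations as lists and insertion at either end\<close>

definition perm_lists :: "nat \<Rightarrow> nat list set" where
  "perm_lists m = permutations_of_set {..<m}"

lemma perm_lists_eq: "perm_lists m = {w. distinct w \<and> set w = {..<m}}"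
  unfolding perm_lists_def permutations_of_set_def by blast

fun descents :: "nat list \<Rightarrow> bool list" where
  "descents (x # y # zs) = (y < x) # descents (y # zs)"
| "descents _ = []"

fun inversions :: "nat list \<Rightarrow> nat" where
  "inversions [] = 0"
| "inversions (x # xs) = length (filter (\<lambda>y. y < x) xs) + inversions xs"

definition bump :: "nat \<Rightarrow> nat \<Rightarrow> nat" where
  "bump c x = (if x < c then x else Suc x)"

text \<open>The two insertions are parametrised by the number of new inversions: \<open>c\<close> is the number of entries smaller than the
new first entry, respectively larger than the new last entry. This makes both add exactly \<open>c\<close> to the number of
inversions and lets the same numbers describe insertions at the two ends.\<close>

definition insert_front :: "nat \<Rightarrow> nat list \<Rightarrow> nat list" where
  "insert_front c u = c # map (bump c) u"

definition insert_back :: "nat \<Rightarrow> nat list \<Rightarrow> nat list" where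
  "insert_back c u = map (bump (length u - c)) u @ [length u - c]"

text \<open>For a permutation this is the number of entries larger than the last one, the counterpart at the back of the first
entry \<open>hd u\<close>.\<close>

definition above_last :: "nat list \<Rightarrow> nat" where
  "above_last u = length u - 1 - last u"

text \<open>A newly inserted first (last) entry with parameter \<open>c\<close> forms a descent with the previous first (last) entry, whose
parameter is \<open>a\<close>, exactly if \<open>a < c\<close>. So this is the list of descents created by successive insertions,
in the order of insertion.\<close>

fun steps :: "nat \<Rightarrow> nat list \<Rightarrow> bool list" where
  "steps a [] = []"
| "steps a (c # cs) = (a < c) # steps c cs"

text \<open>The condition for \<open>cs\<close> to be the parameters of successive insertions into a permutation of length \<open>m\<close>, which
grows by one in each step.\<close>

fun fits :: "nat \<Rightarrow> nat list \<Rightarrow> bool" where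
  "fits m [] = True"
| "fits m (c # cs) = (c \<le> m \<and> fits (Suc m) cs)"

definition codes :: "nat \<Rightarrow> nat \<Rightarrow> nat list set" where
  "codes m p = {cs. length cs = p \<and> fits m cs}"

lemma length_perm_list: "w \<in> perm_lists m \<Longrightarrow> length w = m"
  using distinct_card[of w] by (simp add: perm_lists_eq)

lemma finite_perm_lists [simp]: "finite (perm_lists m)"
proof -
  have "perm_lists m \<subseteq> {w. set w \<subseteq> {..<m} \<and> length w = m}"
    using length_perm_list by (fastforce simp: perm_lists_eq)
  thus ?thesis by (rule finite_subset) (simp add: finite_lists_length_eq)
qed

lemma bump_less_iff [simp]: "bump c x < bump c y \<longleftrightarrow> x < y"
  by (auto simp: bump_def)

lemma inj_bump: "inj_on (bump c) A"
  by (auto simp: bump_def inj_on_def split: if_splits)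

lemma bump_image: "c \<le> m \<Longrightarrow> bump c ` {..<m} = {..<Suc m} - {c}"
proof (intro equalityI subsetI)
  fix y assume c: "c \<le> m" and y: "y \<in> {..<Suc m} - {c}"
  show "y \<in> bump c ` {..<m}"
  proof (cases "y < c")
    case True thus ?thesis using c by (intro image_eqI[of _ _ y]) (auto simp: bump_def)
  next
    case False thus ?thesis using c y by (intro image_eqI[of _ _ "y - 1"]) (auto simp: bump_def)
  qed
qed (auto simp: bump_def split: if_splits)

text \<open>What remains of a permutation after removing one entry, standardised.\<close>

lemma perm_list_unbump:
  assumes "distinct w" "set w = {..<Suc m} - {c}" "c \<le> m"
  shows "\<exists>u\<in>perm_lists m. w = map (bump c) u"
proof -
  have "set w \<subseteq> range (bump c)" using assms bump_image[of c m] by auto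
  then obtain u where u: "w = map (bump c) u"
    by (metis ex_map_conv subsetD rangeE)
  have "bump c ` set u = bump c ` {..<m}" using assms bump_image[of c m] u by simp
  hence "set u = {..<m}" using inj_on_image_eq_iff[OF inj_bump, of "set u" UNIV "{..<m}" c] by simp
  moreover have "distinct u" using assms(1) u by (simp add: distinct_map)
  ultimately show ?thesis using u by (auto simp: perm_lists_eq)
qed

lemma descents_map_bump [simp]: "descents (map (bump c) u) = descents u"
  by (induction u rule: descents.induct) simp_all

lemma inversions_map_bump [simp]: "inversions (map (bump c) u) = inversions u"
  by (induction u) (simp_all add: filter_map o_def)

lemma descents_append1: "u \<noteq> [] \<Longrightarrow> descents (u @ [x]) = descents u @ [x < last u]"
  by (induction u rule: descents.induct) auto

lemma inversions_append1: "inversions (u @ [x]) = inversions u + length (filter (\<lambda>y. x < y) u)"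
  by (induction u) auto

lemma length_descents: "length (descents u) = length u - 1"
  by (induction u rule: descents.induct) auto

lemma length_filter_perm_list:
  assumes "u \<in> perm_lists m"
  shows "length (filter P u) = card {x. x < m \<and> P x}"
proof -
  have "length (filter P u) = card (set (filter P u))"
    using assms by (intro distinct_card[symmetric]) (auto simp: perm_lists_eq)
  also have "set (filter P u) = {x. x < m \<and> P x}" using assms by (auto simp: perm_lists_eq)
  finally show ?thesis .
qed

lemma perm_lists_nonempty: "u \<in> perm_lists m \<Longrightarrow> 0 < m \<Longrightarrow> u \<noteq> []"
  using length_perm_list[of u m] by auto

lemma last_perm_list: "u \<in> perm_lists m \<Longrightarrow> 0 < m \<Longrightarrow> last u < m"
  using perm_lists_nonempty[of u m] last_in_set[of u] by (auto simp: perm_lists_eq)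

lemma insert_front_perm_lists: "u \<in> perm_lists m \<Longrightarrow> c \<le> m \<Longrightarrow> insert_front c u \<in> perm_lists (Suc m)"
  using bump_image[of c m] by (auto simp: perm_lists_eq insert_front_def distinct_map inj_bump)

lemma insert_back_perm_lists: "u \<in> perm_lists m \<Longrightarrow> c \<le> m \<Longrightarrow> insert_back c u \<in> perm_lists (Suc m)"
  using bump_image[of "m - c" m] length_perm_list[of u m]
  by (auto simp: perm_lists_eq insert_back_def distinct_map inj_bump)

lemma inversions_insert_front:
  assumes "u \<in> perm_lists m" "c \<le> m"
  shows "inversions (insert_front c u) = c + inversions u"
proof -
  have "length (filter (\<lambda>y. y < c) (map (bump c) u)) = card {x. x < m \<and> bump c x < c}"
    using length_filter_perm_list[OF assms(1)] by (simp add: filter_map o_def)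
  also have "{x. x < m \<and> bump c x < c} = {..<c}" using assms(2) by (auto simp: bump_def)
  finally show ?thesis by (simp add: insert_front_def)
qed

lemma inversions_insert_back:
  assumes "u \<in> perm_lists m" "c \<le> m"
  shows "inversions (insert_back c u) = c + inversions u"
proof -
  have "length (filter (\<lambda>y. m - c < y) (map (bump (m - c)) u)) = card {x. x < m \<and> m - c < bump (m - c) x}"
    using length_filter_perm_list[OF assms(1)] by (simp add: filter_map o_def)
  also have "{x. x < m \<and> m - c < bump (m - c) x} = {m - c..<m}" by (auto simp: bump_def)
  finally show ?thesis using assms length_perm_list[of u m] by (simp add: insert_back_def inversions_append1)
qed

lemma descents_insert_front:
  assumes "u \<noteq> []"
  shows "descents (insert_front c u) = (hd u < c) # descents u"
proof -
  obtain x xs where u: "u = x # xs" using assms by (cases u) auto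
  have "descents (insert_front c u) = (bump c x < c) # descents (map (bump c) u)"
    by (simp add: u insert_front_def)
  moreover have "bump c x < c \<longleftrightarrow> x < c" by (auto simp: bump_def)
  moreover have "hd u = x" by (simp add: u)
  ultimately show ?thesis by simp
qed

lemma descents_insert_back:
  assumes "u \<in> perm_lists m" "0 < m" "c \<le> m"
  shows "descents (insert_back c u) = descents u @ [above_last u < c]"
proof -
  have ne: "u \<noteq> []" and len: "length u = m" and last: "last u < m"
    using assms perm_lists_nonempty[of u m] last_perm_list[of u m] length_perm_list[of u m] by simp_all
  have "descents (insert_back c u) = descents u @ [m - c < bump (m - c) (last u)]"
    using ne len by (simp add: insert_back_def descents_append1 last_map)
  moreover have "m - c < bump (m - c) (last u) \<longleftrightarrow> above_last u < c"
    using last assms(3) len by (auto simp: bump_def above_last_def)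
  ultimately show ?thesis by simp
qed

lemma hd_insert_front [simp]: "hd (insert_front c u) = c"
  by (simp add: insert_front_def)

lemma above_last_insert_back: "c \<le> length u \<Longrightarrow> above_last (insert_back c u) = c"
  by (simp add: insert_back_def above_last_def)

lemma insert_front_inject: "insert_front c u = insert_front c' u' \<longleftrightarrow> c = c' \<and> u = u'"
  using inj_bump[of c UNIV] by (auto simp: insert_front_def inj_map_eq_map)

lemma insert_back_inject:
  assumes "u \<in> perm_lists m" "u' \<in> perm_lists m" "c \<le> m" "c' \<le> m"
  shows "insert_back c u = insert_back c' u' \<longleftrightarrow> c = c' \<and> u = u'"
proof
  assume "insert_back c u = insert_back c' u'"
  hence "m - c = m - c'" "map (bump (m - c)) u = map (bump (m - c')) u'"
    using assms length_perm_list[of u m] length_perm_list[of u' m] by (auto simp: insert_back_def)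
  moreover from this have "c = c'" using assms by simp
  ultimately show "c = c' \<and> u = u'" using inj_bump[of "m - c" UNIV] by (simp add: inj_map_eq_map)
qed simp

lemma perm_list_insert_frontE:
  assumes "w \<in> perm_lists (Suc m)"
  obtains c u where "c \<le> m" "u \<in> perm_lists m" "w = insert_front c u"
proof -
  obtain c w' where w: "w = c # w'"
    using perm_lists_nonempty[OF assms] by (cases w) simp_all
  have dist: "distinct (c # w')" and set_w: "set (c # w') = {..<Suc m}"
    using assms w by (simp_all add: perm_lists_eq)
  have "c \<in> {..<Suc m}" unfolding set_w[symmetric] by simp
  moreover have "set w' = {..<Suc m} - {c}" unfolding set_w[symmetric] using dist by auto
  ultimately obtain u where "u \<in> perm_lists m" "w' = map (bump c) u"
    using perm_list_unbump[of w' m c] dist by auto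
  thus thesis using that[of c u] w \<open>c \<in> {..<Suc m}\<close> by (simp add: insert_front_def)
qed

lemma perm_list_insert_backE:
  assumes "w \<in> perm_lists (Suc m)"
  obtains c u where "c \<le> m" "u \<in> perm_lists m" "w = insert_back c u"
proof -
  obtain x w' where w: "w = w' @ [x]"
    using perm_lists_nonempty[OF assms] by (cases w rule: rev_cases) simp_all
  have dist: "distinct (w' @ [x])" and set_w: "set (w' @ [x]) = {..<Suc m}"
    using assms w by (simp_all only: perm_lists_eq mem_Collect_eq)
  have x: "x \<in> {..<Suc m}" unfolding set_w[symmetric] by simp
  moreover have "set w' = {..<Suc m} - {x}" unfolding set_w[symmetric] using dist by auto
  ultimately obtain u where u: "u \<in> perm_lists m" "w' = map (bump x) u"
    using perm_list_unbump[of w' m x] dist by auto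
  have "w = insert_back (m - x) u" using w u x length_perm_list[of u m] by (simp add: insert_back_def)
  thus thesis using that[of "m - x" u] u by simp
qed

section \<open>Encoding permutations by successive insertions\<close>

lemma bij_betw_insert_front: "bij_betw (\<lambda>(c, u). insert_front c u) ({..m} \<times> perm_lists m) (perm_lists (Suc m))"
  unfolding bij_betw_def
proof
  show "inj_on (\<lambda>(c, u). insert_front c u) ({..m} \<times> perm_lists m)"
    by (auto simp: inj_on_def insert_front_inject)
  show "(\<lambda>(c, u). insert_front c u) ` ({..m} \<times> perm_lists m) = perm_lists (Suc m)"
  proof (intro equalityI subsetI)
    fix w assume "w \<in> perm_lists (Suc m)"
    then obtain c u where "c \<le> m" "u \<in> perm_lists m" "w = insert_front c u" by (rule perm_list_insert_frontE)
    thus "w \<in> (\<lambda>(c, u). insert_front c u) ` ({..m} \<times> perm_lists m)"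
      by (intro image_eqI[of _ _ "(c, u)"]) simp_all
  qed (auto intro: insert_front_perm_lists)
qed

lemma bij_betw_insert_back: "bij_betw (\<lambda>(c, u). insert_back c u) ({..m} \<times> perm_lists m) (perm_lists (Suc m))"
  unfolding bij_betw_def
proof
  show "inj_on (\<lambda>(c, u). insert_back c u) ({..m} \<times> perm_lists m)"
    by (auto simp: inj_on_def insert_back_inject)
  show "(\<lambda>(c, u). insert_back c u) ` ({..m} \<times> perm_lists m) = perm_lists (Suc m)"
  proof (intro equalityI subsetI)
    fix w assume "w \<in> perm_lists (Suc m)"
    then obtain c u where "c \<le> m" "u \<in> perm_lists m" "w = insert_back c u" by (rule perm_list_insert_backE)
    thus "w \<in> (\<lambda>(c, u). insert_back c u) ` ({..m} \<times> perm_lists m)"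
      by (intro image_eqI[of _ _ "(c, u)"]) simp_all
  qed (auto intro: insert_back_perm_lists)
qed

lemma fits_append1: "fits m (cs @ [c]) \<longleftrightarrow> fits m cs \<and> c \<le> m + length cs"
  by (induction cs arbitrary: m) auto

lemma codes_0 [simp]: "codes m 0 = {[]}"
  by (auto simp: codes_def)

lemma codes_Suc: "codes m (Suc p) = (\<lambda>(cs, c). cs @ [c]) ` (codes m p \<times> {..m + p})"
proof (intro equalityI subsetI)
  fix x assume "x \<in> codes m (Suc p)"
  thus "x \<in> (\<lambda>(cs, c). cs @ [c]) ` (codes m p \<times> {..m + p})"
    by (cases x rule: rev_cases) (auto simp: codes_def fits_append1 image_iff)
qed (auto simp: codes_def fits_append1)

lemma finite_codes [simp]: "finite (codes m p)"
  by (induction p) (auto simp: codes_Suc)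

text \<open>Fixing the number \<open>p\<close> of insertions, a permutation of length \<open>m + p\<close> is the same as a permutation of length
\<open>m\<close> with a code of length \<open>p\<close>, for insertion at the front as well as at the back.\<close>

lemma bij_betw_fold_insert:
  assumes f: "\<And>m. bij_betw (\<lambda>(c, u). f c u) ({..m} \<times> perm_lists m) (perm_lists (Suc m))"
  shows "bij_betw (\<lambda>(cs, u). fold f cs u) (codes m p \<times> perm_lists m) (perm_lists (m + p))"
proof (induction p)
  case 0
  show ?case by (auto simp: bij_betw_def inj_on_def image_def)
next
  case (Suc p)
  \<comment> \<open>Perform all insertions but the last.\<close>
  define g where "g = (\<lambda>(x, u). (last x, fold f (butlast x) u))"
  have "bij_betw g (codes m (Suc p) \<times> perm_lists m) ({..m + p} \<times> perm_lists (m + p))"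
    unfolding bij_betw_def
  proof
    show "inj_on g (codes m (Suc p) \<times> perm_lists m)"
    proof (rule inj_onI, clarify)
      fix x u y v
      assume x: "x \<in> codes m (Suc p)" and u: "u \<in> perm_lists m"
        and y: "y \<in> codes m (Suc p)" and v: "v \<in> perm_lists m" and eq: "g (x, u) = g (y, v)"
      obtain cs c where x': "x = cs @ [c]" "cs \<in> codes m p" using x by (auto simp: codes_Suc)
      obtain ds d where y': "y = ds @ [d]" "ds \<in> codes m p" using y by (auto simp: codes_Suc)
      have "c = d" "fold f cs u = fold f ds v" using eq x' y' by (auto simp: g_def)
      moreover from this have "(cs, u) = (ds, v)"
        using Suc.IH x' y' u v by (intro inj_onD[OF bij_betw_imp_inj_on[OF Suc.IH]]) auto
      ultimately show "x = y \<and> u = v" using x' y' by simp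
    qed
    have "g ` (codes m (Suc p) \<times> perm_lists m) = {..m + p} \<times> (\<lambda>(cs, u). fold f cs u) ` (codes m p \<times> perm_lists m)"
      unfolding codes_Suc by (force simp: g_def image_iff)
    thus "g ` (codes m (Suc p) \<times> perm_lists m) = {..m + p} \<times> perm_lists (m + p)"
      using Suc.IH by (simp add: bij_betw_def)
  qed
  from bij_betw_trans[OF this f]
  have "bij_betw ((\<lambda>(c, u). f c u) \<circ> g) (codes m (Suc p) \<times> perm_lists m) (perm_lists (m + Suc p))" by simp
  moreover have "((\<lambda>(c, u). f c u) \<circ> g) z = (\<lambda>(cs, u). fold f cs u) z"
    if "z \<in> codes m (Suc p) \<times> perm_lists m" for z
    using that by (auto simp: codes_Suc g_def)
  ultimately show ?case by (subst (asm) bij_betw_cong) auto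
qed

lemmas bij_betw_insert_fronts = bij_betw_fold_insert[OF bij_betw_insert_front]
lemmas bij_betw_insert_backs = bij_betw_fold_insert[OF bij_betw_insert_back]

lemma length_steps [simp]: "length (steps a cs) = length cs"
  by (induction cs arbitrary: a) auto

lemma inversions_insert_fronts: "u \<in> perm_lists m \<Longrightarrow> fits m cs \<Longrightarrow> inversions (fold insert_front cs u) = sum_list cs + inversions u"
proof (induction cs arbitrary: m u)
  case (Cons c cs)
  thus ?case using inversions_insert_front[of u m c] insert_front_perm_lists[of u m c] Cons.IH[of "insert_front c u" "Suc m"]
    by simp
qed simp

lemma inversions_insert_backs: "u \<in> perm_lists m \<Longrightarrow> fits m cs \<Longrightarrow> inversions (fold insert_back cs u) = sum_list cs + inversions u"
proof (induction cs arbitrary: m u)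
  case (Cons c cs)
  thus ?case using inversions_insert_back[of u m c] insert_back_perm_lists[of u m c] Cons.IH[of "insert_back c u" "Suc m"]
    by simp
qed simp

lemma hd_insert_fronts: "hd (fold insert_front cs u) = last (hd u # cs)"
  by (induction cs arbitrary: u) auto

lemma above_last_insert_backs: "u \<in> perm_lists m \<Longrightarrow> fits m cs \<Longrightarrow> above_last (fold insert_back cs u) = last (above_last u # cs)"
  by (induction cs arbitrary: m u) (auto simp: above_last_insert_back length_perm_list dest: insert_back_perm_lists)

text \<open>The code determines the descents among the inserted entries; only the first comparison involves the old
permutation, and only through its first entry. For insertions at the front the descents come out reversed.\<close>

lemma descents_insert_fronts: "u \<noteq> [] \<Longrightarrow> descents (fold insert_front cs u) = rev (steps (hd u) cs) @ descents u"
proof (induction cs arbitrary: u)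
  case (Cons c cs)
  have "insert_front c u \<noteq> []" by (simp add: insert_front_def)
  thus ?case using Cons by (simp add: descents_insert_front)
qed simp

lemma descents_insert_backs:
  "u \<in> perm_lists m \<Longrightarrow> 0 < m \<Longrightarrow> fits m cs \<Longrightarrow> descents (fold insert_back cs u) = descents u @ steps (above_last u) cs"
proof (induction cs arbitrary: m u)
  case (Cons c cs)
  thus ?case using insert_back_perm_lists[of u m c] length_perm_list[of u m]
    by (simp add: descents_insert_back above_last_insert_back)
qed simp

definition perms_with :: "nat \<Rightarrow> bool list \<Rightarrow> nat list set" where
  "perms_with k D = {w \<in> perm_lists (Suc (length D)). descents w = D \<and> inversions w = k}"

definition desc_count :: "nat \<Rightarrow> bool list \<Rightarrow> nat" where
  "desc_count k D = card (perms_with k D)"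

lemma finite_perms_with [simp]: "finite (perms_with k D)"
  by (simp add: perms_with_def)

lemma card_filter_bij:
  assumes "bij_betw f A B"
  shows "card {b \<in> B. P b} = card {a \<in> A. P (f a)}"
proof -
  have "bij_betw f {a \<in> A. P (f a)} {b \<in> B. P b}"
    using assms by (auto simp: bij_betw_def inj_on_def)
  thus ?thesis by (simp add: bij_betw_same_card)
qed

text \<open>The two expansions below differ only in the statistic \<open>hd\<close> or \<open>above_last\<close> to which the first code entry is
compared. All comparisons of permutation counts are made summand by summand in them.\<close>

lemma desc_count_front:
  "desc_count k (rev E @ D) = (\<Sum>cs\<in>codes (Suc (length D)) (length E).
     card {u \<in> perm_lists (Suc (length D)). descents u = D \<and> steps (hd u) cs = E \<and> sum_list cs + inversions u = k})"
proof -
  let ?m = "Suc (length D)" and ?p = "length E"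
  let ?C = "\<lambda>cs. {u \<in> perm_lists ?m. descents u = D \<and> steps (hd u) cs = E \<and> sum_list cs + inversions u = k}"
  have "desc_count k (rev E @ D) = card {w \<in> perm_lists (?m + ?p). descents w = rev E @ D \<and> inversions w = k}"
    by (simp add: desc_count_def perms_with_def add.commute)
  also have "\<dots> = card {z \<in> codes ?m ?p \<times> perm_lists ?m.
      descents ((\<lambda>(cs, u). fold insert_front cs u) z) = rev E @ D \<and> inversions ((\<lambda>(cs, u). fold insert_front cs u) z) = k}"
    by (rule card_filter_bij[OF bij_betw_insert_fronts])
  also have "{z \<in> codes ?m ?p \<times> perm_lists ?m.
      descents ((\<lambda>(cs, u). fold insert_front cs u) z) = rev E @ D \<and> inversions ((\<lambda>(cs, u). fold insert_front cs u) z) = k}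
    = (SIGMA cs:codes ?m ?p. ?C cs)"
  proof -
    have "descents (fold insert_front cs u) = rev E @ D \<and> inversions (fold insert_front cs u) = k
      \<longleftrightarrow> descents u = D \<and> steps (hd u) cs = E \<and> sum_list cs + inversions u = k"
      if "cs \<in> codes ?m ?p" "u \<in> perm_lists ?m" for cs u
      using that descents_insert_fronts[of u cs] inversions_insert_fronts[of u ?m cs] perm_lists_nonempty[of u ?m]
      by (auto simp: codes_def)
    thus ?thesis by auto
  qed
  also have "card \<dots> = (\<Sum>cs\<in>codes ?m ?p. card (?C cs))" by (rule card_SigmaI) simp_all
  finally show ?thesis .
qed

lemma desc_count_back:
  "desc_count k (D @ E) = (\<Sum>cs\<in>codes (Suc (length D)) (length E).
     card {u \<in> perm_lists (Suc (length D)). descents u = D \<and> steps (above_last u) cs = E \<and> sum_list cs + inversions u = k})"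
proof -
  let ?m = "Suc (length D)" and ?p = "length E"
  let ?C = "\<lambda>cs. {u \<in> perm_lists ?m. descents u = D \<and> steps (above_last u) cs = E \<and> sum_list cs + inversions u = k}"
  have "desc_count k (D @ E) = card {w \<in> perm_lists (?m + ?p). descents w = D @ E \<and> inversions w = k}"
    by (simp add: desc_count_def perms_with_def)
  also have "\<dots> = card {z \<in> codes ?m ?p \<times> perm_lists ?m.
      descents ((\<lambda>(cs, u). fold insert_back cs u) z) = D @ E \<and> inversions ((\<lambda>(cs, u). fold insert_back cs u) z) = k}"
    by (rule card_filter_bij[OF bij_betw_insert_backs])
  also have "{z \<in> codes ?m ?p \<times> perm_lists ?m.
      descents ((\<lambda>(cs, u). fold insert_back cs u) z) = D @ E \<and> inversions ((\<lambda>(cs, u). fold insert_back cs u) z) = k}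
    = (SIGMA cs:codes ?m ?p. ?C cs)"
  proof -
    have "descents (fold insert_back cs u) = D @ E \<and> inversions (fold insert_back cs u) = k
      \<longleftrightarrow> descents u = D \<and> steps (above_last u) cs = E \<and> sum_list cs + inversions u = k"
      if "cs \<in> codes ?m ?p" "u \<in> perm_lists ?m" for cs u
      using that descents_insert_backs[of u ?m cs] inversions_insert_backs[of u ?m cs]
        length_perm_list[of u ?m] length_descents[of u]
      by (auto simp: codes_def)
    thus ?thesis by auto
  qed
  also have "card \<dots> = (\<Sum>cs\<in>codes ?m ?p. card (?C cs))" by (rule card_SigmaI) simp_all
  finally show ?thesis .
qed

section \<open>The forced cyclic count and its rotation invariance\<close>

lemma card_steps_split:
  assumes "finite A" "length cs = Suc (length E)"
  shows "card {u \<in> A. Q u \<and> steps (a u) cs = True # E \<and> R u} + card {u \<in> A. Q u \<and> steps (a u) cs = False # E \<and> R u}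
    = card {u \<in> A. Q u \<and> steps (hd cs) (tl cs) = E \<and> R u}"
proof -
  obtain c ds where cs: "cs = c # ds" using assms(2) by (cases cs) auto
  have "card {u \<in> A. Q u \<and> steps (a u) cs = True # E \<and> R u} + card {u \<in> A. Q u \<and> steps (a u) cs = False # E \<and> R u}
    = card ({u \<in> A. Q u \<and> steps (a u) cs = True # E \<and> R u} \<union> {u \<in> A. Q u \<and> steps (a u) cs = False # E \<and> R u})"
    using assms(1) by (intro card_Un_disjoint[symmetric]) auto
  also have "{u \<in> A. Q u \<and> steps (a u) cs = True # E \<and> R u} \<union> {u \<in> A. Q u \<and> steps (a u) cs = False # E \<and> R u}
    = {u \<in> A. Q u \<and> steps (hd cs) (tl cs) = E \<and> R u}"
    unfolding cs by auto
  finally show ?thesis .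
qed

text \<open>Summing over both values of the descent next to \<open>D\<close> removes the only comparison that involves the permutation
with descent word \<open>D\<close>. The remaining condition on the code does not depend on the end at which the entries
are inserted.\<close>

lemma desc_count_rotate:
  "desc_count k (rev E @ True # D) + desc_count k (rev E @ False # D)
    = desc_count k (D @ True # E) + desc_count k (D @ False # E)"
proof -
  let ?m = "Suc (length D)" and ?C = "codes (Suc (length D)) (Suc (length E))"
  let ?S = "\<Sum>cs\<in>?C. card {u \<in> perm_lists ?m. descents u = D \<and> steps (hd cs) (tl cs) = E \<and> sum_list cs + inversions u = k}"
  have "desc_count k (rev E @ True # D) + desc_count k (rev E @ False # D) = ?S"
    using desc_count_front[of k "True # E" D] desc_count_front[of k "False # E" D]
    by (simp flip: sum.distrib) (intro sum.cong refl card_steps_split, simp_all add: codes_def)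
  moreover have "desc_count k (D @ True # E) + desc_count k (D @ False # E) = ?S"
    using desc_count_back[of k D "True # E"] desc_count_back[of k D "False # E"]
    by (simp flip: sum.distrib) (intro sum.cong refl card_steps_split, simp_all add: codes_def)
  ultimately show ?thesis by simp
qed

text \<open>Recursion from the end of the word: \<open>cyc_count_rev k r c\<close> is the value at the word \<open>rev r\<close> followed by \<open>c\<close>
further \<open>False\<close>s, so the last \<open>True\<close> is eliminated according to the forced relation
\<open>N (P T F^c) = m (F^c P) - N (P F^(c + 1))\<close>.\<close>

fun cyc_count_rev :: "nat \<Rightarrow> bool list \<Rightarrow> nat \<Rightarrow> int" where
  "cyc_count_rev k [] c = 0"
| "cyc_count_rev k (False # r) c = cyc_count_rev k r (Suc c)"
| "cyc_count_rev k (True # r) c = int (desc_count k (replicate c False @ rev r)) - cyc_count_rev k r (Suc c)"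

definition cyc_count :: "nat \<Rightarrow> bool list \<Rightarrow> int" where
  "cyc_count k b = cyc_count_rev k (rev b) 0"

lemma cyc_count_append_False: "cyc_count k (b @ replicate c False) = cyc_count_rev k (rev b) c"
proof -
  have "cyc_count_rev k (replicate c False @ r) d = cyc_count_rev k r (c + d)" for r d
    by (induction c arbitrary: d) auto
  thus ?thesis by (simp add: cyc_count_def)
qed

lemma cyc_count_all_False [simp]: "cyc_count k (replicate c False) = 0"
  using cyc_count_append_False[of k "[]" c] by simp

lemma cyc_count_last_True:
  "cyc_count k (b @ True # replicate c False)
    = int (desc_count k (replicate c False @ b)) - cyc_count k (b @ replicate (Suc c) False)"
  using cyc_count_append_False[of k "b @ [True]" c] cyc_count_append_False[of k b "Suc c"] by simp

lemma cyc_count_True: "cyc_count k (b @ [True]) = int (desc_count k b) - cyc_count k (b @ [False])"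
  using cyc_count_last_True[of k b 0] by simp

lemma replicate_False_or_last_True: "(\<exists>c. b = replicate c False) \<or> (\<exists>d c. b = d @ True # replicate c False)"
proof (induction b)
  case Nil
  show ?case by (intro disjI1 exI[of _ 0]) simp
next
  case (Cons x b)
  from Cons.IH show ?case
  proof
    assume "\<exists>c. b = replicate c False"
    then obtain c where c: "b = replicate c False" by blast
    show ?thesis
    proof (cases x)
      case True
      thus ?thesis using c by (intro disjI2 exI[of _ "[]"] exI[of _ c]) simp
    next
      case False
      thus ?thesis using c by (intro disjI1 exI[of _ "Suc c"]) simp
    qed
  next
    assume "\<exists>d c. b = d @ True # replicate c False"
    then obtain d c where "b = d @ True # replicate c False" by blast
    thus ?thesis by (intro disjI2 exI[of _ "x # d"] exI[of _ c]) simp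
  qed
qed

text \<open>Induction on the number of \<open>True\<close>s. Expanding both sides at their last \<open>True\<close>s leads, up to rotations of
words with fewer \<open>True\<close>s, to the same value at \<open>d @ F^(c + 2)\<close>; the remaining counts of permutations
cancel by \<open>desc_count_rotate\<close>.\<close>

lemma cyc_count_rotate: "cyc_count k (b @ [x]) = cyc_count k (x # b)"
proof (induction "length (filter id b)" arbitrary: b x rule: less_induct)
  case less
  consider c where "b = replicate c False" | d c where "b = d @ True # replicate c False"
    using replicate_False_or_last_True by blast
  thus ?case
  proof cases
    case 1
    show ?thesis
    proof (cases x)
      case True
      thus ?thesis
        using 1 cyc_count_last_True[of k "[]" c] cyc_count_last_True[of k "replicate c False" 0]
          cyc_count_all_False[of k "Suc c"]
        by (simp add: replicate_append_same)
    next
      case False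
      thus ?thesis using 1 by (simp add: replicate_append_same)
    qed
  next
    case 2
    let ?F = "\<lambda>i. replicate i False"
    have IH: "cyc_count k ((d @ ?F (Suc c)) @ [y]) = cyc_count k (y # d @ ?F (Suc c))" for y
      using less.hyps[of "d @ ?F (Suc c)" y] by (simp add: 2)
    have last: "cyc_count k (d @ True # ?F (Suc c))
        = int (desc_count k (?F (Suc c) @ d)) - cyc_count k (d @ ?F (Suc (Suc c)))"
      by (rule cyc_count_last_True)
    have F: "?F (Suc i) = ?F i @ [False]" for i by (simp add: replicate_append_same)
    show ?thesis
    proof (cases x)
      case True
      have "cyc_count k (True # b) = int (desc_count k (?F c @ True # d)) - cyc_count k (True # d @ ?F (Suc c))"
        using cyc_count_last_True[of k "True # d" c] by (simp add: 2)
      moreover have "cyc_count k (True # d @ ?F (Suc c))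
          = int (desc_count k (d @ ?F (Suc c))) - cyc_count k (d @ ?F (Suc (Suc c)))"
        using IH[of True] cyc_count_True[of k "d @ ?F (Suc c)"] F[of "Suc c"] by simp
      moreover have "cyc_count k (b @ [True]) = int (desc_count k b) - cyc_count k (d @ True # ?F (Suc c))"
        using cyc_count_True[of k b] F[of c] by (simp add: 2)
      moreover have "desc_count k (?F c @ True # d) + desc_count k (?F (Suc c) @ d) = desc_count k b + desc_count k (d @ ?F (Suc c))"
        using desc_count_rotate[of k "?F c" d] by (simp add: 2 F replicate_app_Cons_same)
      ultimately show ?thesis using last True by simp
    next
      case False
      have "cyc_count k (False # b) = int (desc_count k (?F c @ False # d)) - cyc_count k (False # d @ ?F (Suc c))"
        using cyc_count_last_True[of k "False # d" c] by (simp add: 2)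
      moreover have "cyc_count k (False # d @ ?F (Suc c)) = cyc_count k (d @ ?F (Suc (Suc c)))"
        using IH[of False] F[of "Suc c"] by simp
      moreover have "?F c @ False # d = ?F (Suc c) @ d" by (simp add: replicate_app_Cons_same)
      moreover have "b @ [False] = d @ True # ?F (Suc c)" using F[of c] by (simp add: 2)
      ultimately show ?thesis using last False by simp
    qed
  qed
qed

lemma cyc_count_append_commute: "cyc_count k (a @ b) = cyc_count k (b @ a)"
proof (induction a arbitrary: b)
  case (Cons x a)
  have "cyc_count k ((x # a) @ b) = cyc_count k (a @ b @ [x])"
    using cyc_count_rotate[of k "a @ b" x] by simp
  also have "\<dots> = cyc_count k (b @ x # a)" using Cons.IH[of "b @ [x]"] by simp
  finally show ?case by simp
qed simp

section \<open>Gathering the ascents does not increase the cyclic count\<close>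

lemma steps_all_False_iff: "steps a cs = replicate (length cs) False \<longleftrightarrow> sorted_wrt (\<ge>) (a # cs)"
proof (induction cs arbitrary: a)
  case (Cons c cs)
  have "steps a (c # cs) = replicate (length (c # cs)) False \<longleftrightarrow> c \<le> a \<and> sorted_wrt (\<ge>) (c # cs)"
    using Cons.IH[of c] by auto
  thus ?case by (auto dest: order_trans)
qed simp

lemma sum_list_steps_True: "steps s cs = replicate (length cs) True \<Longrightarrow> s * length cs \<le> sum_list cs"
proof (induction cs arbitrary: s)
  case (Cons c cs)
  hence "s < c" "c * length cs \<le> sum_list cs" by auto
  moreover have "s * length cs \<le> c * length cs" using \<open>s < c\<close> by simp
  moreover have "s * length (c # cs) = s + s * length cs" "sum_list (c # cs) = c + sum_list cs" by simp_all
  ultimately show ?case by linarith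
qed simp

lemma sum_list_shift_down:
  "(\<forall>e\<in>set es. s \<le> e) \<Longrightarrow> sum_list (map (\<lambda>e. e - s) es) + s * length es = sum_list (es :: nat list)"
  by (induction es) auto

lemma sum_list_shift_up: "sum_list (map (\<lambda>e. e + s) es) = sum_list (es :: nat list) + s * length es"
  by (induction es) auto

lemma fits_shift_down: "fits m es \<Longrightarrow> fits m (map (\<lambda>e. e - s) es)"
  by (induction es arbitrary: m) (auto intro: order_trans[OF diff_le_self])

lemma fits_bounded: "(\<forall>e\<in>set es. e \<le> m) \<Longrightarrow> fits m es"
proof (induction es arbitrary: m)
  case (Cons e es)
  thus ?case using Cons.IH[of "Suc m"] by (simp add: le_SucI)
qed simp

lemma last_sorted_ge: "sorted_wrt (\<ge>) (es :: nat list) \<Longrightarrow> e \<in> set es \<Longrightarrow> last es \<le> e"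
  by (induction es) auto

text \<open>Changing the code of a permutation while keeping the permutation into which its entries are inserted is
injective as soon as it is injective on codes.\<close>

lemma card_le_recode:
  assumes bij: "bij_betw (\<lambda>(cs, u). f cs u) (C \<times> P) V" and "finite W" "A \<subseteq> V"
    and inj: "\<And>cs u cs' u'. cs \<in> C \<Longrightarrow> u \<in> P \<Longrightarrow> f cs u \<in> A \<Longrightarrow> cs' \<in> C \<Longrightarrow> u' \<in> P \<Longrightarrow> f cs' u' \<in> A
      \<Longrightarrow> g cs = g cs' \<Longrightarrow> cs = cs'"
    and maps: "\<And>cs u. cs \<in> C \<Longrightarrow> u \<in> P \<Longrightarrow> f cs u \<in> A \<Longrightarrow> g cs \<in> C \<and> f (g cs) u \<in> W"
  shows "card A \<le> card W"
proof -
  have inj_f: "cs = cs' \<and> u = u'" if "cs \<in> C" "u \<in> P" "cs' \<in> C" "u' \<in> P" "f cs u = f cs' u'" for cs u cs' u'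
    using that inj_onD[OF bij_betw_imp_inj_on[OF bij], of "(cs, u)" "(cs', u')"] by simp
  have "\<exists>z. fst z \<in> C \<and> snd z \<in> P \<and> f (fst z) (snd z) = v" if "v \<in> A" for v
  proof -
    have "v \<in> (\<lambda>(cs, u). f cs u) ` (C \<times> P)" using bij \<open>A \<subseteq> V\<close> that unfolding bij_betw_def by blast
    then obtain cs u where "cs \<in> C" "u \<in> P" "v = f cs u" by auto
    thus ?thesis by (intro exI[of _ "(cs, u)"]) simp
  qed
  then obtain z where z: "fst (z v) \<in> C \<and> snd (z v) \<in> P \<and> f (fst (z v)) (snd (z v)) = v" if "v \<in> A" for v
    by metis
  have maps': "g (fst (z v)) \<in> C" "f (g (fst (z v))) (snd (z v)) \<in> W" if "v \<in> A" for v
    using maps[of "fst (z v)" "snd (z v)"] z[OF that] that by simp_all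
  show ?thesis
  proof (rule card_inj_on_le[of "\<lambda>v. f (g (fst (z v))) (snd (z v))"])
    show "inj_on (\<lambda>v. f (g (fst (z v))) (snd (z v))) A"
    proof (rule inj_onI)
      fix v w assume v: "v \<in> A" and w: "w \<in> A"
        and eq: "f (g (fst (z v))) (snd (z v)) = f (g (fst (z w))) (snd (z w))"
      have *: "g (fst (z v)) = g (fst (z w))" "snd (z v) = snd (z w)"
        using inj_f[OF _ _ _ _ eq] maps' z v w by simp_all
      have "fst (z v) = fst (z w)"
        using inj[of "fst (z v)" "snd (z v)" "fst (z w)" "snd (z w)"] z[OF v] z[OF w] v w *(1) by simp
      thus "v = w" using z[OF v] z[OF w] *(2) by metis
    qed
  qed (use maps'(2) \<open>finite W\<close> in auto)
qed

text \<open>The last \<open>p\<close> steps of \<open>D\<close> are ascents, so the last \<open>p\<close> entries are inserted at the back with weakly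
decreasing parameters, the smallest of them being \<open>above_last\<close>. If that is at least \<open>s\<close>, then \<open>s\<close> can be
subtracted from all of them. This keeps the descents and removes \<open>s * p\<close> inversions.\<close>

lemma card_above_last_le:
  assumes D: "D = Y @ replicate p False" and p: "0 < p"
  shows "card {v \<in> perms_with j D. s \<le> above_last v}
    \<le> card {w \<in> perm_lists (Suc (length D)). descents w = D \<and> inversions w + s * p = j}"
proof (rule card_le_recode[OF bij_betw_insert_backs[of "Suc (length Y)" p], where g = "map (\<lambda>e. e - s)"])
  let ?m = "Suc (length Y)"
  let ?A = "{v \<in> perms_with j D. s \<le> above_last v}"
  have len: "Suc (length D) = ?m + p" by (simp add: D)
  show "finite {w \<in> perm_lists (Suc (length D)). descents w = D \<and> inversions w + s * p = j}" by simp
  show "?A \<subseteq> perm_lists (?m + p)" unfolding perms_with_def len by blast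
  have Z: "descents u = Y \<and> sorted_wrt (\<ge>) (above_last u # es) \<and> sum_list es + inversions u = j \<and> (\<forall>e\<in>set es. s \<le> e)"
    if es: "es \<in> codes ?m p" and u: "u \<in> perm_lists ?m" and A: "fold insert_back es u \<in> ?A" for es u
  proof -
    have fits: "fits ?m es" and lenes: "length es = p" using es by (auto simp: codes_def)
    have "length (descents u) = length Y" using length_descents[of u] length_perm_list[OF u] by simp
    moreover have "descents u @ steps (above_last u) es = Y @ replicate p False"
      using A descents_insert_backs[OF u _ fits] by (simp add: perms_with_def D)
    ultimately have "descents u = Y" and "steps (above_last u) es = replicate (length es) False"
      unfolding lenes using append_eq_append_conv[of "descents u" Y "steps (above_last u) es" "replicate p False"]
      by blast+
    moreover from this(2) have sorted: "sorted_wrt (\<ge>) (above_last u # es)" by (simp only: steps_all_False_iff)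
    moreover have "sum_list es + inversions u = j"
      using A inversions_insert_backs[OF u fits] by (simp add: perms_with_def)
    moreover have "s \<le> last es" using A above_last_insert_backs[OF u fits] lenes p by auto
    hence "\<forall>e\<in>set es. s \<le> e" using sorted last_sorted_ge[of es] by fastforce
    ultimately show ?thesis by blast
  qed
  have restore: "map (\<lambda>e. e + s) (map (\<lambda>e. e - s) es) = es" if "\<forall>e\<in>set es. s \<le> e" for es
    using that by (simp add: map_idI)
  show "es = es'" if "es \<in> codes ?m p" "u \<in> perm_lists ?m" "fold insert_back es u \<in> ?A"
    "es' \<in> codes ?m p" "u' \<in> perm_lists ?m" "fold insert_back es' u' \<in> ?A"
    "map (\<lambda>e. e - s) es = map (\<lambda>e. e - s) es'" for es u es' u'
    using restore[of es] restore[of es'] Z[OF that(1-3)] Z[OF that(4-6)] that(7) by metis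
  fix es u assume es: "es \<in> codes ?m p" and u: "u \<in> perm_lists ?m" and A: "fold insert_back es u \<in> ?A"
  let ?es = "map (\<lambda>e. e - s) es"
  have fits: "fits ?m ?es" and lenes: "length es = p" using es fits_shift_down by (auto simp: codes_def)
  hence es': "?es \<in> codes ?m p" by (simp add: codes_def)
  have "sorted_wrt (\<ge>) ?es" using Z[OF es u A] by (simp add: sorted_wrt_map sorted_wrt_mono_rel[of _ "(\<ge>)"] diff_le_mono)
  hence "sorted_wrt (\<ge>) (above_last u # ?es)" using Z[OF es u A] by (auto intro: order_trans[OF diff_le_self])
  hence "steps (above_last u) ?es = replicate p False" using steps_all_False_iff[of "above_last u" ?es] lenes by simp
  hence "descents (fold insert_back ?es u) = D" using descents_insert_backs[OF u _ fits] Z[OF es u A] D by simp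
  moreover have "inversions (fold insert_back ?es u) + s * p = j"
    using inversions_insert_backs[OF u fits] sum_list_shift_down[of es s] Z[OF es u A] lenes by simp
  moreover have "fold insert_back ?es u \<in> perm_lists (Suc (length D))"
    using bij_betwE[OF bij_betw_insert_backs[of ?m p]] es' u unfolding len by fastforce
  ultimately show "?es \<in> codes ?m p \<and> fold insert_back ?es u
      \<in> {w \<in> perm_lists (Suc (length D)). descents w = D \<and> inversions w + s * p = j}"
    using es' by blast
qed

text \<open>The inverse move at the other end: the first entries are inserted with one descent followed by \<open>p\<close> ascents, and \<open>s\<close>
is added to all \<open>Suc p\<close> parameters, which makes the first entry at least \<open>s\<close>. The bound on \<open>j\<close> guarantees
that the enlarged parameters still fit.\<close>

lemma card_le_hd:
  assumes D: "D = replicate p False @ True # X" and s: "0 < s" and j: "j < Suc (length D)"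
  shows "card {w \<in> perm_lists (Suc (length D)). descents w = D \<and> inversions w + s * Suc p = j}
    \<le> card {v \<in> perms_with j D. s \<le> hd v}"
proof (rule card_le_recode[OF bij_betw_insert_fronts[of "Suc (length X)" "Suc p"], where g = "map (\<lambda>e. e + s)"])
  let ?m = "Suc (length X)"
  let ?A = "{w \<in> perm_lists (Suc (length D)). descents w = D \<and> inversions w + s * Suc p = j}"
  have len: "Suc (length D) = ?m + Suc p" by (simp add: D)
  show "finite {v \<in> perms_with j D. s \<le> hd v}" by simp
  show "?A \<subseteq> perm_lists (?m + Suc p)" unfolding len by blast
  show "es = es'" if "map (\<lambda>e. e + s) es = map (\<lambda>e. e + s) es'" for es es'
    using that by (simp add: inj_map_eq_map[of "\<lambda>e. e + s"])
  fix es u assume es: "es \<in> codes ?m (Suc p)" and u: "u \<in> perm_lists ?m" and A: "fold insert_front es u \<in> ?A"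
  have une: "u \<noteq> []" using perm_lists_nonempty[OF u] by simp
  have fits: "fits ?m es" and lenes: "length es = Suc p" using es by (auto simp: codes_def)
  have "length (descents u) = length X" using length_descents[of u] length_perm_list[OF u] by simp
  moreover have "rev (steps (hd u) es) @ descents u = (replicate p False @ [True]) @ X"
    using A descents_insert_fronts[OF une, of es] by (simp add: D)
  ultimately have desc: "descents u = X" and "rev (steps (hd u) es) = replicate p False @ [True]"
    using append_eq_append_conv[of "rev (steps (hd u) es)" "replicate p False @ [True]" "descents u" X] lenes
    by simp_all
  from this(2) have steps: "steps (hd u) es = True # replicate p False"
    by (metis rev_rev_ident rev_append rev_replicate rev.simps append_Nil append_Cons)
  then obtain c cs where ccs: "es = c # cs" by (cases es) auto
  have c: "hd u < c" and cs: "steps c cs = replicate (length cs) False" and lencs: "length cs = p"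
    using steps lenes by (auto simp: ccs)
  have sorted: "sorted_wrt (\<ge>) es" using cs by (simp only: steps_all_False_iff ccs)
  have inv: "sum_list es + inversions u + s * Suc p = j"
    using A inversions_insert_fronts[OF u fits] by simp
  let ?es = "map (\<lambda>e. e + s) es"
  \<comment> \<open>The largest parameter \<open>c\<close> is at most \<open>j - s * Suc p\<close>, so after raising it is at most
    \<open>j - s * p \<le> length D - p\<close>, as \<open>s \<ge> 1\<close>.\<close>
  have "c \<le> sum_list es" by (simp add: ccs)
  moreover have "p \<le> s * p" using s by simp
  moreover have "s * Suc p = s + s * p" by simp
  ultimately have "c + s \<le> ?m" using inv j len by linarith
  hence fits': "fits ?m ?es" using sorted by (intro fits_bounded) (auto simp: ccs intro: order_trans)
  hence es': "?es \<in> codes ?m (Suc p)" using lenes by (simp add: codes_def)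
  have "steps (c + s) (map (\<lambda>e. e + s) cs) = replicate (length (map (\<lambda>e. e + s) cs)) False"
    using sorted unfolding steps_all_False_iff by (simp add: ccs sorted_wrt_map)
  hence "steps (hd u) ?es = True # replicate p False" using c lencs by (simp add: ccs)
  hence "descents (fold insert_front ?es u) = D" using descents_insert_fronts[OF une, of ?es] desc by (simp add: D)
  moreover have "inversions (fold insert_front ?es u) = j"
    using inversions_insert_fronts[OF u fits'] sum_list_shift_up[of s es] inv lenes by simp
  moreover have "fold insert_front ?es u \<in> perm_lists (Suc (length D))"
    using bij_betwE[OF bij_betw_insert_fronts[of ?m "Suc p"]] es' u unfolding len by fastforce
  moreover have "s \<le> hd (fold insert_front ?es u)"
    using hd_insert_fronts[of ?es u] lenes by (simp add: ccs last_map)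
  ultimately show "?es \<in> codes ?m (Suc p) \<and> fold insert_front ?es u \<in> {v \<in> perms_with j D. s \<le> hd v}"
    using es' unfolding perms_with_def by blast
qed

text \<open>Composing the two moves: the \<open>s * Suc p\<close> inversions taken from the final run of ascents are given to the initial one.
So among the permutations with descent word \<open>D\<close> and \<open>j\<close> inversions, a large first entry is at least as
frequent as a last entry with many larger entries.\<close>

lemma card_above_last_le_hd:
  assumes "D = Y @ replicate (Suc p) False" "D = replicate p False @ True # X" "s = 0 \<or> j < Suc (length D)"
  shows "card {v \<in> perms_with j D. s \<le> above_last v} \<le> card {v \<in> perms_with j D. s \<le> hd v}"
proof (cases "s = 0")
  case False
  thus ?thesis
    using card_above_last_le[OF assms(1), of j s] card_le_hd[OF assms(2), of s j] assms(3) by (meson le_trans neq0_conv zero_less_Suc)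
qed simp

text \<open>In the expansions of both sides, the first code entry \<open>s\<close> must not be a descent, so \<open>s \<le> above_last u\<close> on one side and
\<open>s \<le> hd u\<close> on the other, and the remaining code entries increase strictly from \<open>s\<close>. If \<open>s > 0\<close>, the code uses up
at least \<open>Suc q\<close> of the \<open>k\<close> inversions, which is what \<open>card_above_last_le_hd\<close> asks for.\<close>

lemma desc_count_exchange:
  assumes D: "D = Y @ replicate (Suc p) False" "D = replicate p False @ True # X"
    and k: "k < Suc q + Suc (length D)"
  shows "desc_count k (D @ False # replicate q True) \<le> desc_count k (replicate q True @ False # D)"
proof -
  let ?m = "Suc (length D)"
  have "desc_count k (D @ False # replicate q True) = (\<Sum>cs\<in>codes ?m (Suc q). card {u \<in> perm_lists ?m.
      descents u = D \<and> steps (above_last u) cs = False # replicate q True \<and> sum_list cs + inversions u = k})"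
    using desc_count_back[of k D "False # replicate q True"] by simp
  also have "\<dots> \<le> (\<Sum>cs\<in>codes ?m (Suc q). card {u \<in> perm_lists ?m.
      descents u = D \<and> steps (hd u) cs = False # replicate q True \<and> sum_list cs + inversions u = k})"
  proof (rule sum_mono)
    fix cs assume "cs \<in> codes ?m (Suc q)"
    then obtain s ds where cs: "cs = s # ds" "length ds = q" by (cases cs) (auto simp: codes_def)
    let ?C = "\<lambda>a. {u \<in> perm_lists ?m. descents u = D \<and> steps (a u) cs = False # replicate q True \<and> sum_list cs + inversions u = k}"
    show "card (?C above_last) \<le> card (?C hd)"
    proof (cases "steps s ds = replicate q True \<and> sum_list cs \<le> k")
      case True
      have "s * q \<le> sum_list ds" using True sum_list_steps_True[of s ds] cs by simp
      hence "s = 0 \<or> Suc q \<le> sum_list cs" by (cases s) (auto simp: cs)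
      hence "s = 0 \<or> k - sum_list cs < ?m" using k by auto
      note card_above_last_le_hd[OF D this]
      moreover have "?C a = {v \<in> perms_with (k - sum_list cs) D. s \<le> a v}" for a
        using True by (auto simp: perms_with_def cs)
      ultimately show ?thesis by simp
    next
      case False
      hence "?C above_last = {}" by (auto simp: cs)
      thus ?thesis by (simp only: card.empty)
    qed
  qed
  also have "\<dots> = desc_count k (replicate q True @ False # D)"
    using desc_count_front[of k "False # replicate q True" D] by simp
  finally show ?thesis .
qed

text \<open>Moving one \<open>False\<close> from the run after the leading \<open>True\<close>s to the final run. Rotating either word until one
of its leading \<open>True\<close>s stands at the end and eliminating this \<open>True\<close> leaves two words that are rotations of each
other, so only the counts of permutations in \<open>desc_count_exchange\<close> have to be compared.\<close>

lemma cyc_count_exchange: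
  assumes D: "D = Y @ replicate (Suc p) False" "D = replicate p False @ True # X"
    and k: "k < Suc q + Suc (length D)"
  shows "cyc_count k (replicate (Suc q) True @ D @ [False]) \<le> cyc_count k (replicate (Suc q) True @ False # D)"
proof -
  let ?T = "replicate q True"
  have T: "replicate (Suc q) True = ?T @ [True]" by (simp add: replicate_append_same)
  have "cyc_count k (replicate (Suc q) True @ D @ [False]) = cyc_count k ((D @ False # ?T) @ [True])"
    using cyc_count_append_commute[of k "replicate (Suc q) True" "D @ [False]"] unfolding T by simp
  also have "\<dots> = int (desc_count k (D @ False # ?T)) - cyc_count k ((D @ [False]) @ ?T @ [False])"
    using cyc_count_True[of k "D @ False # ?T"] by simp
  also have "\<dots> \<le> int (desc_count k (?T @ False # D)) - cyc_count k ((?T @ [False]) @ D @ [False])"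
    using desc_count_exchange[OF assms] cyc_count_append_commute[of k "D @ [False]" "?T @ [False]"] by simp
  also have "\<dots> = cyc_count k ((?T @ False # D) @ [True])"
    using cyc_count_True[of k "?T @ False # D"] by simp
  also have "\<dots> = cyc_count k (replicate (Suc q) True @ False # D)"
    using cyc_count_rotate[of k "?T @ False # D" True] by simp
  finally show ?thesis .
qed

definition runs_le :: "nat \<Rightarrow> bool list \<Rightarrow> bool" where
  "runs_le g R \<longleftrightarrow> (\<forall>A r B. R = A @ replicate r False @ B \<longrightarrow> r \<le> g)"

lemma runs_le_suffix: "runs_le g (A @ R) \<Longrightarrow> runs_le g R"
  unfolding runs_le_def by (metis append.assoc)

lemma runs_le_mono: "runs_le g R \<Longrightarrow> g \<le> g' \<Longrightarrow> runs_le g' R"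
  unfolding runs_le_def using le_trans by blast

text \<open>Repeated exchanges. A \<open>True\<close> at the front of \<open>R\<close> joins the leading ones, and a \<open>False\<close> is moved to
the final run. The exchange requires the first run of \<open>False\<close>s to be no longer than the final one; this stays true
since the final run only grows.\<close>

lemma cyc_count_gather:
  assumes "k < Suc q + length R + g" "runs_le g R"
  shows "cyc_count k (replicate (Suc q + length (filter id R)) True @ replicate (length (filter Not R) + g) False)
    \<le> cyc_count k (replicate (Suc q) True @ R @ replicate g False)"
  using assms
proof (induction "length R" arbitrary: q R g)
  case 0
  thus ?case by simp
next
  case (Suc l)
  then obtain x R' where R: "R = x # R'" by (cases R) auto
  show ?case
  proof (cases x)
    case True
    have "cyc_count k (replicate (Suc q + length (filter id R)) True @ replicate (length (filter Not R) + g) False)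
        \<le> cyc_count k (replicate (Suc (Suc q)) True @ R' @ replicate g False)"
      using Suc.hyps(1)[of R' "Suc q" g] Suc.hyps(2) Suc.prems runs_le_suffix[of g "[x]" R'] True by (simp add: R)
    also have "replicate (Suc (Suc q)) True @ R' @ replicate g False = replicate (Suc q) True @ R @ replicate g False"
      using True by (simp add: R replicate_app_Cons_same)
    finally show ?thesis .
  next
    case False
    have IH: "cyc_count k (replicate (Suc q + length (filter id R)) True @ replicate (length (filter Not R) + g) False)
        \<le> cyc_count k (replicate (Suc q) True @ R' @ replicate (Suc g) False)"
      using Suc.hyps(1)[of R' q "Suc g"] Suc.hyps(2) Suc.prems runs_le_suffix[of g "[x]" R']
        runs_le_mono[of g R' "Suc g"] False by (simp add: R)
    show ?thesis
    proof (cases "True \<in> set R'")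
      case False
      hence "R' = replicate (length R') False" by (metis (full_types) replicate_length_same)
      then obtain c where "R' = replicate c False" by blast
      hence "R' @ replicate (Suc g) False = R @ replicate g False" using \<open>\<not> x\<close> R
        by (simp add: replicate_app_Cons_same)
      thus ?thesis using IH by (simp only:)
    next
      case True
      then obtain A X where "R' = A @ True # X" "True \<notin> set A" by (meson split_list_first)
      moreover from this have "A = replicate (length A) False" by (metis (full_types) replicate_length_same)
      ultimately obtain p where R': "R' = replicate p False @ True # X" by metis
      have "R = [] @ replicate (Suc p) False @ True # X" using R R' \<open>\<not> x\<close> by simp
      hence p: "Suc p \<le> g" using Suc.prems(2) unfolding runs_le_def by blast
      let ?D = "R' @ replicate g False"
      have "replicate g False = replicate (g - Suc p) False @ replicate (Suc p) False"
        using p by (metis le_add_diff_inverse2 replicate_add)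
      hence "?D = (R' @ replicate (g - Suc p) False) @ replicate (Suc p) False" by simp
      moreover have "?D = replicate p False @ True # (X @ replicate g False)" by (simp add: R')
      moreover have "k < Suc q + Suc (length ?D)" using Suc.prems(1) by (simp add: R)
      ultimately have "cyc_count k (replicate (Suc q) True @ ?D @ [False]) \<le> cyc_count k (replicate (Suc q) True @ False # ?D)"
        by (rule cyc_count_exchange)
      moreover have "?D @ [False] = R' @ replicate (Suc g) False" by (simp add: replicate_append_same)
      moreover have "False # ?D = R @ replicate g False" using R \<open>\<not> x\<close> by simp
      ultimately show ?thesis using IH by simp
    qed
  qed
qed

lemma cyc_count_rotate_n: "cyc_count k (rotate n b) = cyc_count k b"
  by (metis append_take_drop_id cyc_count_append_commute rotate_drop_take)

lemma length_filter_rotate: "length (filter P (rotate n b)) = length (filter P b)"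
  by (metis (no_types, lifting) add.commute append_take_drop_id filter_append length_append rotate_drop_take)

text \<open>Choose the rotation of the form \<open>True # R @ F^g\<close> with \<open>g\<close> maximal. A longer run inside \<open>R\<close> could be
rotated to the end, together with the \<open>False\<close>s that would otherwise stand at the front.\<close>

lemma rotation_with_longest_final_run:
  assumes "True \<in> set b"
  obtains n R g where "rotate n b = True # R @ replicate g False" "runs_le g R"
proof -
  let ?G = "{g. \<exists>n R. rotate n b = True # R @ replicate g False}"
  obtain x z where b: "b = x @ True # z" using assms by (meson split_list)
  have "rotate (length x) b = True # (z @ x) @ replicate 0 False" by (simp add: b rotate_append)
  hence ne: "?G \<noteq> {}" by blast
  have "g \<le> length b" if "g \<in> ?G" for g
  proof -
    from that obtain n R where "rotate n b = True # R @ replicate g False" by blast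
    hence "length b = length (True # R @ replicate g False)" by (metis length_rotate)
    thus ?thesis by simp
  qed
  hence fin: "finite ?G" by (intro finite_subset[of ?G "{..length b}"]) auto
  obtain n R where nR: "rotate n b = True # R @ replicate (Max ?G) False" using Max_in[OF fin ne] by blast
  have "runs_le (Max ?G) R"
    unfolding runs_le_def
  proof (intro allI impI)
    fix A r B assume R: "R = A @ replicate r False @ B"
    let ?b = "B @ replicate (Max ?G) False @ True # A"
    obtain C R' where C: "?b = C @ True # R'" "True \<notin> set C" using split_list_first[of True ?b] by auto
    have C': "C = replicate (length C) False" using C(2) by (metis (full_types) replicate_length_same)
    have "rotate (length (True # A @ replicate r False) + n) b = B @ replicate (Max ?G) False @ True # A @ replicate r False"
      using nR rotate_append[of "True # A @ replicate r False" "B @ replicate (Max ?G) False"]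
      by (simp only: R rotate_rotate[symmetric]) simp
    also have "\<dots> = C @ True # R' @ replicate r False" using C(1) by simp
    finally have "rotate (length C + (length (True # A @ replicate r False) + n)) b = True # R' @ replicate r False @ C"
      using rotate_append[of C "True # R' @ replicate r False"] by (simp only: rotate_rotate[symmetric]) simp
    moreover have "replicate r False @ C = replicate (r + length C) False"
      using C' by (metis replicate_add)
    ultimately have "r + length C \<in> ?G" unfolding mem_Collect_eq by metis
    thus "r \<le> Max ?G" using Max_ge[OF fin, of "r + length C"] by linarith
  qed
  thus thesis using that nR by blast
qed

lemma cyc_count_ge_gathered:
  assumes "k < length b" "True \<in> set b"
  shows "cyc_count k (replicate (length (filter id b)) True @ replicate (length (filter Not b)) False) \<le> cyc_count k b"
proof -
  obtain n R g where b: "rotate n b = True # R @ replicate g False" and R: "runs_le g R"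
    using rotation_with_longest_final_run[OF assms(2)] .
  have "length b = length (True # R @ replicate g False)" using b by (metis length_rotate)
  hence "k < Suc 0 + length R + g" using assms(1) by simp
  note cyc_count_gather[OF this R]
  moreover have "length (filter id b) = Suc 0 + length (filter id R)"
    using b length_filter_rotate[of id n b] by simp
  moreover have "length (filter Not b) = length (filter Not R) + g"
    using b length_filter_rotate[of Not n b] by simp
  ultimately show ?thesis using b cyc_count_rotate_n[of k n b] by simp
qed

section \<open>Hook-shaped descent words and partitions into distinct parts\<close>

definition distinct_partitions :: "nat \<Rightarrow> nat set set" where
  "distinct_partitions k = {S. finite S \<and> 0 \<notin> S \<and> \<Sum>S = k}"

lemma distinct_partition_le: "S \<in> distinct_partitions k \<Longrightarrow> x \<in> S \<Longrightarrow> x \<le> k"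
  unfolding distinct_partitions_def using member_le_sum[of x S "\<lambda>x. x"] by auto

lemma finite_distinct_partitions [simp]: "finite (distinct_partitions k)"
proof (rule finite_subset)
  show "distinct_partitions k \<subseteq> Pow {..k}" using distinct_partition_le by blast
qed simp

lemma card_distinct_partition_le: "S \<in> distinct_partitions k \<Longrightarrow> card S \<le> k"
proof -
  assume S: "S \<in> distinct_partitions k"
  have "1 \<le> x" if "x \<in> S" for x using that S by (cases x) (auto simp: distinct_partitions_def)
  hence "(\<Sum>x\<in>S. 1) \<le> \<Sum>S" by (rule sum_mono)
  thus "card S \<le> k" using S by (simp add: distinct_partitions_def)
qed

lemma steps_all_True_iff: "steps a cs = replicate (length cs) True \<longleftrightarrow> sorted_wrt (<) (a # cs)"
proof (induction cs arbitrary: a)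
  case (Cons c cs)
  have "steps a (c # cs) = replicate (length (c # cs)) True \<longleftrightarrow> a < c \<and> sorted_wrt (<) (c # cs)"
    using Cons.IH[of c] by auto
  thus ?case by (simp only: sorted_wrt2[OF transp_on_less])
qed simp

text \<open>All entries are positive, so each entry leaves room for at least one unit per later entry.\<close>

lemma fits_if_sum_small: "0 \<notin> set cs \<Longrightarrow> sum_list cs < m + length cs \<Longrightarrow> fits m cs"
proof (induction cs arbitrary: m)
  case (Cons c cs)
  have "sum_list (map (\<lambda>_. 1) cs) \<le> sum_list (map (\<lambda>x. x) cs)"
    using Cons.prems(1) by (intro sum_list_mono) (metis One_nat_def Suc_leI list.set_intros(2) neq0_conv)
  hence "length cs \<le> sum_list cs" by (simp add: sum_list_triv)
  moreover have "0 < c" "0 \<notin> set cs" using Cons.prems(1) by auto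
  ultimately show ?case using Cons.IH[of "Suc m"] Cons.prems(2) by simp
qed simp

lemma sorted_if_no_descents: "descents u = replicate l False \<Longrightarrow> sorted u"
proof (induction u arbitrary: l rule: descents.induct)
  case (1 x y zs)
  then obtain l' where "l = Suc l'" by (cases l) auto
  thus ?case using 1 by auto
qed simp_all

lemma descents_upt: "descents [0..<Suc a] = replicate a False"
proof (induction a)
  case (Suc a)
  have "descents ([0..<Suc a] @ [Suc a]) = descents [0..<Suc a] @ [Suc a < last [0..<Suc a]]"
    by (rule descents_append1) simp
  moreover have "last [0..<Suc a] = a" by simp
  moreover have "[0..<Suc (Suc a)] = [0..<Suc a] @ [Suc a]" by simp
  ultimately show ?case using Suc.IH by (simp only: replicate_append_same[symmetric] replicate_Suc) simp
qed simp

lemma inversions_upt: "inversions [0..<a] = 0"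
  by (induction a) (simp_all add: inversions_append1)

lemma above_last_upt: "above_last [0..<Suc a] = 0"
  by (simp add: above_last_def)

lemma perm_list_no_descents_iff:
  "u \<in> perm_lists (Suc a) \<and> descents u = replicate a False \<longleftrightarrow> u = [0..<Suc a]"
proof
  assume u: "u \<in> perm_lists (Suc a) \<and> descents u = replicate a False"
  hence "sorted u" using sorted_if_no_descents[of u a] by blast
  moreover have "distinct u" and "set u = set [0..<Suc a]"
    using u by (simp_all only: perm_lists_eq mem_Collect_eq set_upt atLeast0LessThan)
  ultimately show "u = [0..<Suc a]" using sorted_distinct_set_unique sorted_upt distinct_upt by blast
next
  assume u: "u = [0..<Suc a]"
  have "[0..<Suc a] \<in> perm_lists (Suc a)" by (simp only: perm_lists_eq mem_Collect_eq distinct_upt set_upt atLeast0LessThan)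
  thus "u \<in> perm_lists (Suc a) \<and> descents u = replicate a False" unfolding u using descents_upt by blast
qed

text \<open>The only permutation without descents is the identity, which has no inversions. A permutation with descent word
\<open>F^a T^b\<close> arises from it by insertions at the back with strictly increasing positive parameters, that is, from the
parts of a partition into \<open>b\<close> distinct parts. Since \<open>k \<le> a + b\<close>, every such partition of \<open>k\<close> fits.\<close>

lemma desc_count_hook:
  assumes k: "k \<le> a + b"
  shows "desc_count k (replicate a False @ replicate b True) = card {S \<in> distinct_partitions k. card S = b}"
proof -
  let ?C = "{cs \<in> codes (Suc a) b. steps 0 cs = replicate b True \<and> sum_list cs = k}"
  let ?S = "{S \<in> distinct_partitions k. card S = b}"
  have "desc_count k (replicate a False @ replicate b True) = (\<Sum>cs\<in>codes (Suc a) b.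
     card {u \<in> perm_lists (Suc a). descents u = replicate a False \<and> steps (above_last u) cs = replicate b True
       \<and> sum_list cs + inversions u = k})"
    using desc_count_back[of k "replicate a False" "replicate b True"] by simp
  also have "\<dots> = (\<Sum>cs\<in>codes (Suc a) b. if steps 0 cs = replicate b True \<and> sum_list cs = k then 1 else 0)"
  proof (rule sum.cong[OF refl])
    fix cs
    have "{u \<in> perm_lists (Suc a). descents u = replicate a False \<and> steps (above_last u) cs = replicate b True
        \<and> sum_list cs + inversions u = k}
      = {u. u = [0..<Suc a] \<and> steps (above_last u) cs = replicate b True \<and> sum_list cs + inversions u = k}"
      by (simp only: perm_list_no_descents_iff[symmetric] conj_assoc)
    also have "\<dots> = (if steps 0 cs = replicate b True \<and> sum_list cs = k then {[0..<Suc a]} else {})"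
      using above_last_upt[of a] inversions_upt[of "Suc a"] by (auto simp del: upt_Suc)
    finally show "card {u \<in> perm_lists (Suc a). descents u = replicate a False \<and> steps (above_last u) cs = replicate b True
        \<and> sum_list cs + inversions u = k} = (if steps 0 cs = replicate b True \<and> sum_list cs = k then 1 else 0)"
      by (simp del: upt_Suc)
  qed
  also have "\<dots> = card ?C" by (simp add: sum.If_cases Int_def)
  also have "card ?C = card ?S"
  proof (rule bij_betw_same_card[OF bij_betw_byWitness[where f = set and f' = sorted_list_of_set]])
    have C: "sorted_wrt (<) (0 # cs)" if "cs \<in> ?C" for cs
      using that steps_all_True_iff[of 0 cs] by (auto simp: codes_def)
    show "\<forall>cs\<in>?C. sorted_list_of_set (set cs) = cs"
    proof
      fix cs assume "cs \<in> ?C"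
      hence "sorted cs" "distinct cs" using C[of cs] by (simp_all add: strict_sorted_iff)
      thus "sorted_list_of_set (set cs) = cs" by (rule sorted_list_of_set.idem_if_sorted_distinct)
    qed
    show "\<forall>S\<in>?S. set (sorted_list_of_set S) = S" by (simp add: distinct_partitions_def)
    show "set ` ?C \<subseteq> ?S"
    proof
      fix S assume "S \<in> set ` ?C"
      then obtain cs where cs: "cs \<in> ?C" "S = set cs" by blast
      have "distinct cs" "0 \<notin> set cs" using C[OF cs(1)] by (auto simp: strict_sorted_iff)
      thus "S \<in> ?S" using cs
        by (auto simp: distinct_partitions_def codes_def distinct_card sum.distinct_set_conv_list)
    qed
    show "sorted_list_of_set ` ?S \<subseteq> ?C"
    proof
      fix cs assume "cs \<in> sorted_list_of_set ` ?S"
      then obtain S where S: "S \<in> ?S" "cs = sorted_list_of_set S" by blast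
      hence set_cs: "set cs = S" and dist: "distinct cs" and sorted: "sorted cs" and 0: "0 \<notin> set cs"
        by (auto simp: distinct_partitions_def)
      have len: "length cs = b" using S by simp
      have sum: "sum_list cs = k"
        using S(1) set_cs dist sum.distinct_set_conv_list[OF dist, of "\<lambda>x. x"] by (simp add: distinct_partitions_def)
      have "fits (Suc a) cs" using k sum len 0 by (intro fits_if_sum_small) simp_all
      moreover have "sorted_wrt (<) (0 # cs)" using sorted dist 0 by (auto simp: strict_sorted_iff intro: gr0I)
      ultimately show "cs \<in> ?C" using steps_all_True_iff[of 0 cs] len sum by (simp add: codes_def)
    qed
  qed
  finally show ?thesis .
qed

section \<open>Franklin's involution\<close>

text \<open>The length of the run of consecutive numbers that ends at the largest part. If \<open>0 \<notin> S\<close>, the truncated subtraction does no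
harm, because the run ends before \<open>0\<close> is reached.\<close>

definition top_run :: "nat set \<Rightarrow> nat" where
  "top_run S = (LEAST r. Max S - r \<notin> S)"

text \<open>If the smallest part \<open>s\<close> is not longer than the top run, it is removed and its units are given to the \<open>s\<close> largest
parts; otherwise one unit is taken from each part of the top run to form a new smallest part. Shifting a run of
consecutive numbers by one means exchanging one of its ends, hence the formulas.\<close>

definition franklin :: "nat set \<Rightarrow> nat set" where
  "franklin S = (if Min S \<le> top_run S
     then insert (Suc (Max S)) (S - {Min S, Suc (Max S) - Min S})
     else insert (top_run S) (insert (Max S - top_run S) (S - {Max S})))"

text \<open>These are the partitions on which the two cases of the involution break down, the first one for \<open>e = 0\<close> and the
second one for \<open>e = 1\<close>.\<close>

definition staircase :: "nat set \<Rightarrow> bool" where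
  "staircase S \<longleftrightarrow> (\<exists>r e. 0 < r \<and> e \<le> 1 \<and> S = {r + e..<2 * r + e})"

lemma
  assumes "finite S" "S \<noteq> {}" "0 \<notin> S"
  shows top_run_notin: "Max S - top_run S \<notin> S"
    and top_run_in: "j < top_run S \<Longrightarrow> Max S - j \<in> S"
    and top_run_pos: "0 < top_run S"
    and top_run_le: "top_run S \<le> Max S"
proof -
  have 0: "Max S - Max S \<notin> S" using assms(3) by simp
  show 1: "Max S - top_run S \<notin> S" unfolding top_run_def by (rule LeastI[of "\<lambda>r. Max S - r \<notin> S"]) (rule 0)
  show "Max S - j \<in> S" if "j < top_run S" using not_less_Least[of j "\<lambda>r. Max S - r \<notin> S"] that
    unfolding top_run_def by blast
  show "top_run S \<le> Max S" unfolding top_run_def by (rule Least_le) (rule 0)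
  have "Max S \<in> S" using assms by simp
  thus "0 < top_run S" using 1 by (cases "top_run S") auto
qed

lemma top_run_eqI: "Max S - r \<notin> S \<Longrightarrow> (\<And>j. j < r \<Longrightarrow> Max S - j \<in> S) \<Longrightarrow> top_run S = r"
  unfolding top_run_def by (rule Least_equality) (use not_le in blast)+

text \<open>After removal of the smallest part \<open>s\<close> and raising the \<open>s\<close> largest parts, the top run has length
exactly \<open>s\<close> and all parts exceed \<open>s\<close>, so the second case of the involution applies and undoes the move.
Only the staircases \<open>{s..<2 * s}\<close> have to be excluded: there \<open>s\<close> itself belongs to the parts to be raised.\<close>

lemma franklin_merge:
  assumes S: "finite S" "S \<noteq> {}" "0 \<notin> S" "\<not> staircase S" and case_A: "Min S \<le> top_run S"
  defines "S' \<equiv> franklin S"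
  shows "finite S'" "0 \<notin> S'" "\<Sum>S' = \<Sum>S" "card S = Suc (card S')" "\<not> staircase S'" "franklin S' = S"
proof -
  define s M R where "s = Min S" and "M = Max S" and "R = S - {s, Suc M - s}"
  have MS: "M \<in> S" "s \<in> S" and bounds: "\<And>x. x \<in> S \<Longrightarrow> s \<le> x \<and> x \<le> M" using S by (auto simp: s_def M_def)
  have s: "0 < s" using MS S(3) by (cases s) auto
  have sr: "s \<le> top_run S" and rM: "top_run S \<le> M" using case_A top_run_le[OF S(1-3)] by (simp_all add: s_def M_def)
  have run: "x \<in> S" if "M - top_run S < x" "x \<le> M" for x
    using top_run_in[OF S(1-3), of "M - x"] that by (simp add: M_def)
  \<comment> \<open>The smallest part is not among the \<open>s\<close> largest ones.\<close>
  have ss: "2 * s < Suc M"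
  proof (rule ccontr)
    assume "\<not> 2 * s < Suc M"
    moreover have "s \<le> Suc M - top_run S" using bounds[OF run[of "Suc M - top_run S"]] rM top_run_pos[OF S(1-3)] by simp
    ultimately have M: "Suc M = 2 * s" and "top_run S = s" using sr rM by linarith+
    have "S = {s + 0..<2 * s + 0}"
    proof (intro equalityI subsetI)
      fix x assume "x \<in> S"
      thus "x \<in> {s + 0..<2 * s + 0}" using bounds[of x] M by simp
    next
      fix x assume "x \<in> {s + 0..<2 * s + 0}"
      hence "M - top_run S < x" "x \<le> M" using M \<open>top_run S = s\<close> s by auto
      thus "x \<in> S" by (rule run)
    qed
    thus False using S(4) s unfolding staircase_def by blast
  qed
  have sM: "Suc M - s \<in> S" using run[of "Suc M - s"] s sr rM by simp
  have S_eq: "S = insert s (insert (Suc M - s) R)" and R: "finite R" "s \<notin> R" "Suc M - s \<notin> R" "Suc M \<notin> R"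
    using MS sM S(1) bounds[of "Suc M"] by (auto simp: R_def)
  have S': "S' = insert (Suc M) R" using case_A by (simp add: S'_def franklin_def s_def M_def R_def)
  have R_bounds: "s < x \<and> x \<le> M" if "x \<in> R" for x using that bounds[of x] by (auto simp: R_def)
  show fin': "finite S'" and 0: "0 \<notin> S'" using R S(3) by (auto simp: S' R_def)
  have ne: "s \<noteq> Suc M - s" using ss by simp
  show "\<Sum>S' = \<Sum>S" using R ne ss by (simp add: S' S_eq)
  show "card S = Suc (card S')" using R ne by (simp add: S' S_eq)
  have S'_bounds: "s < x \<and> x \<le> Suc M" if "x \<in> S'" for x
    using that R_bounds[of x] ss unfolding S' by auto
  have in': "Suc M \<in> S'" by (simp add: S')
  have max': "Max S' = Suc M" by (rule Max_eqI[OF fin']) (use S'_bounds in' in blast)+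
  have min': "s < Min S'" using S'_bounds[of "Min S'"] Min_in[OF fin'] in' by blast
  have run': "top_run S' = s"
  proof (rule top_run_eqI)
    show "Max S' - s \<notin> S'" unfolding max' using R s ss by (auto simp: S')
    fix j assume j: "j < s"
    show "Max S' - j \<in> S'"
    proof (cases "j = 0")
      case True
      thus ?thesis using in' max' by simp
    next
      case False
      have "Suc M - j \<in> S" using run[of "Suc M - j"] j sr rM False by simp
      thus ?thesis unfolding max' using j ss by (auto simp: S' R_def)
    qed
  qed
  show "franklin S' = S"
    unfolding franklin_def run' max' using min' R(4) by (simp add: S' S_eq insert_commute)
  show "\<not> staircase S'"
  proof
    assume "staircase S'"
    then obtain r e where re: "0 < r" "e \<le> 1" "S' = {r + e..<2 * r + e}" unfolding staircase_def by blast
    have "Max S' = 2 * r + e - 1" unfolding re(3) using re(1) by (intro Max_eqI) auto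
    moreover have "Min S' = r + e" unfolding re(3) using re(1) by (intro Min_eqI) auto
    moreover have "Suc M - s \<notin> S'" using R s by (auto simp: S')
    hence "\<not> (r + e \<le> Suc M - s \<and> Suc M - s < 2 * r + e)" using re(3) by simp
    ultimately show False using max' min' ss s re(1,2) by linarith
  qed
qed

text \<open>The new smallest part \<open>r\<close> is at most the length of the new top run, so the first case of the involution applies
and undoes the move. Only the staircases \<open>{r + 1..<2 * r + 1}\<close> have to be excluded: there the lowest part of
the lowered run would coincide with the new part \<open>r\<close>.\<close>

lemma franklin_split:
  assumes S: "finite S" "S \<noteq> {}" "0 \<notin> S" "\<not> staircase S" and case_B: "top_run S < Min S"
  defines "S' \<equiv> franklin S"
  shows "finite S'" "0 \<notin> S'" "\<Sum>S' = \<Sum>S" "card S' = Suc (card S)" "\<not> staircase S'" "franklin S' = S"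
proof -
  define r M R where "r = top_run S" and "M = Max S" and "R = S - {M}"
  have MS: "M \<in> S" and bounds: "\<And>x. x \<in> S \<Longrightarrow> r < x \<and> x \<le> M" using S case_B by (auto simp: r_def M_def)
  have r: "0 < r" "r \<le> M" "M - r \<notin> S" using top_run_pos top_run_le top_run_notin S(1-3) by (simp_all add: r_def M_def)
  have run: "x \<in> S" if "M - r < x" "x \<le> M" for x
    using top_run_in[OF S(1-3), of "M - x"] that r by (simp add: M_def r_def)
  \<comment> \<open>The new part \<open>r\<close> is smaller than the lowest part of the lowered run.\<close>
  have rr: "r < M - r"
  proof (rule ccontr)
    assume *: "\<not> r < M - r"
    have "r < Suc (M - r)" using bounds[OF run[of "Suc (M - r)"]] r by simp
    hence M: "M = 2 * r" using * r by simp
    have "S = {r + 1..<2 * r + 1}"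
    proof (intro equalityI subsetI)
      fix x assume "x \<in> S"
      thus "x \<in> {r + 1..<2 * r + 1}" using bounds[of x] M by simp
    next
      fix x assume "x \<in> {r + 1..<2 * r + 1}"
      thus "x \<in> S" using run[of x] M by simp
    qed
    thus False using S(4) r unfolding staircase_def by blast
  qed
  have S_eq: "S = insert M R" and R: "finite R" "M \<notin> R" "r \<notin> R" "M - r \<notin> R"
    using MS S(1) bounds[of r] r by (auto simp: R_def)
  have S': "S' = insert r (insert (M - r) R)" using case_B by (simp add: S'_def franklin_def r_def M_def R_def)
  have R_bounds: "r < x \<and> x < M" if "x \<in> R" for x using that bounds[of x] by (auto simp: R_def)
  show fin': "finite S'" and "0 \<notin> S'" using R S(3) r rr by (auto simp: S' R_def)
  show "\<Sum>S' = \<Sum>S" using R rr by (simp add: S' S_eq)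
  show "card S' = Suc (card S)" using R rr by (simp add: S' S_eq)
  have S'_bounds: "r \<le> x \<and> x \<le> M - 1" if "x \<in> S'" for x
    using that R_bounds[of x] r rr unfolding S' by auto
  have min': "Min S' = r" by (rule Min_eqI[OF fin']) (use S'_bounds S' in blast)+
  have "M - 1 \<in> S'"
  proof (cases "r = 1")
    case False
    thus ?thesis using run[of "M - 1"] r rr by (auto simp: S' R_def)
  qed (simp add: S')
  hence max': "Max S' = M - 1" using fin' by (intro Max_eqI) (use S'_bounds in blast)+
  have "Max S' - j \<in> S'" if "j < r" for j
  proof (cases "Suc j = r")
    case True
    hence "Max S' - j = M - r" by (simp add: max')
    thus ?thesis by (simp add: S')
  next
    case False
    hence "Max S' - j \<in> R" using that run[of "M - 1 - j"] rr by (auto simp: max' R_def)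
    thus ?thesis by (simp add: S')
  qed
  moreover have "Max S' - top_run S' \<notin> S'" using fin' \<open>0 \<notin> S'\<close> by (intro top_run_notin) (auto simp: S')
  ultimately have run': "r \<le> top_run S'" by (meson not_le)
  show "franklin S' = S"
    unfolding franklin_def min' max' using run' R rr by (auto simp: S' S_eq)
  show "\<not> staircase S'"
  proof
    assume "staircase S'"
    then obtain q e where qe: "0 < q" "e \<le> 1" "S' = {q + e..<2 * q + e}" unfolding staircase_def by blast
    have "Max S' = 2 * q + e - 1" unfolding qe(3) using qe(1) by (intro Max_eqI) auto
    moreover have "Min S' = q + e" unfolding qe(3) using qe(1) by (intro Min_eqI) auto
    ultimately show False using max' min' rr qe(1,2) by linarith
  qed
qed

lemma franklin_involution:
  assumes "0 < k"
  defines "P \<equiv> {S \<in> distinct_partitions k. \<not> staircase S}"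
  assumes "S \<in> P"
  shows "franklin S \<in> P" "franklin (franklin S) = S" "card (franklin S) = Suc (card S) \<or> card S = Suc (card (franklin S))"
proof -
  have S: "finite S" "S \<noteq> {}" "0 \<notin> S" "\<not> staircase S" "\<Sum>S = k"
    using assms by (auto simp: distinct_partitions_def)
  note A = franklin_merge[OF S(1-4)] and B = franklin_split[OF S(1-4)]
  show "franklin S \<in> P" using A B S(5) by (cases "Min S \<le> top_run S") (auto simp: P_def distinct_partitions_def)
  show "franklin (franklin S) = S" using A B by (cases "Min S \<le> top_run S") auto
  show "card (franklin S) = Suc (card S) \<or> card S = Suc (card (franklin S))"
    using A B by (cases "Min S \<le> top_run S") auto
qed

section \<open>Evaluating the gathered cyclic count\<close>

definition parts_count :: "nat \<Rightarrow> nat \<Rightarrow> nat" where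
  "parts_count k t = card {S \<in> distinct_partitions k. card S = t}"

text \<open>In the alternating partial sum \<open>h t\<close>, the partitions whose Franklin partner also has fewer than \<open>t\<close> parts
cancel. The inductive step splits the partitions with \<open>t\<close> parts by whether the partner is smaller or larger.\<close>

lemma alternating_count_of_pairing:
  fixes h :: "nat \<Rightarrow> int"
  assumes k: "0 < k" and no: "\<And>S. S \<in> distinct_partitions k \<Longrightarrow> \<not> staircase S"
    and h0: "h 0 = 0" and h: "\<And>t. t < n \<Longrightarrow> h (Suc t) = int (parts_count k t) - h t" and "t \<le> n"
  shows "h t = int (card {S \<in> distinct_partitions k. card S < t \<and> t \<le> card (franklin S)})"
  using \<open>t \<le> n\<close>
proof (induction t)
  case 0
  thus ?case using h0 by simp
next
  case (Suc t)
  let ?P = "distinct_partitions k"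
  have f: "franklin S \<in> ?P \<and> franklin (franklin S) = S
      \<and> (card (franklin S) = Suc (card S) \<or> card S = Suc (card (franklin S)))" if "S \<in> ?P" for S
    using franklin_involution[OF k, of S] no that by blast
  let ?X = "{S \<in> ?P. card S = t \<and> card (franklin S) = Suc t}"
  let ?Y = "{S \<in> ?P. card S < t \<and> t \<le> card (franklin S)}"
  let ?Z = "{S \<in> ?P. card S = t \<and> t = Suc (card (franklin S))}"
  have "bij_betw franklin ?Y ?Z"
  proof (rule bij_betw_byWitness[where f' = franklin])
    show "\<forall>S\<in>?Y. franklin (franklin S) = S" "\<forall>S\<in>?Z. franklin (franklin S) = S" using f by blast+
    show "franklin ` ?Y \<subseteq> ?Z"
    proof (rule image_subsetI)
      fix S assume "S \<in> ?Y"
      thus "franklin S \<in> ?Z" using f[of S] by auto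
    qed
    show "franklin ` ?Z \<subseteq> ?Y"
    proof (rule image_subsetI)
      fix S assume "S \<in> ?Z"
      thus "franklin S \<in> ?Y" using f[of S] by auto
    qed
  qed
  hence YZ: "card ?Y = card ?Z" by (rule bij_betw_same_card)
  have "{S \<in> ?P. card S = t} = ?X \<union> ?Z" using f by fastforce
  hence "parts_count k t = card (?X \<union> ?Z)" by (simp only: parts_count_def)
  also have "\<dots> = card ?X + card ?Z" by (rule card_Un_disjoint) auto
  finally have "parts_count k t = card ?X + card ?Y" using YZ by simp
  moreover have "{S \<in> ?P. card S < Suc t \<and> Suc t \<le> card (franklin S)} = ?X" using f by fastforce
  moreover have "h (Suc t) = int (parts_count k t) - int (card ?Y)" using h[of t] Suc by simp
  ultimately show ?case by simp
qed

text \<open>Every partition of \<open>k\<close> into distinct parts has at most \<open>k < n\<close> parts, so the alternating sum up to \<open>n\<close> is complete.\<close>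

lemma signed_count_of_recurrence:
  fixes h :: "nat \<Rightarrow> int"
  assumes kn: "k < n" and h0: "h 0 = 0" and h: "\<And>t. t < n \<Longrightarrow> h (Suc t) = int (parts_count k t) - h t"
  shows "(\<Sum>S\<in>distinct_partitions k. (-1) ^ card S) = - ((-1) ^ n * h n)"
proof -
  let ?P = "distinct_partitions k"
  have "(\<Sum>i<t. (-1) ^ i * int (parts_count k i)) = - ((-1) ^ t * h t)" if "t \<le> n" for t
    using that
  proof (induction t)
    case (Suc t)
    thus ?case by (simp add: h algebra_simps)
  qed (simp add: h0)
  moreover have "(\<Sum>S\<in>?P. (-1) ^ card S) = (\<Sum>i<n. \<Sum>S\<in>{S \<in> ?P. card S = i}. (-1) ^ card S :: int)"
  proof (rule sum.group[symmetric])
    show "card ` ?P \<subseteq> {..<n}" using card_distinct_partition_le kn by fastforce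
  qed simp_all
  moreover have "(\<Sum>S\<in>{S \<in> ?P. card S = i}. (-1) ^ card S :: int) = (-1) ^ i * int (parts_count k i)" for i
    by (simp add: parts_count_def)
  ultimately show ?thesis by (simp add: mult.commute)
qed

lemma signed_count_nonstaircase:
  assumes "0 < k"
  shows "(\<Sum>S\<in>{S \<in> distinct_partitions k. \<not> staircase S}. (-1) ^ card S :: int) = 0"
proof -
  let ?Q = "{S \<in> distinct_partitions k. \<not> staircase S}"
  note f = franklin_involution[OF assms]
  have "(\<Sum>S\<in>?Q. (-1) ^ card S :: int) = (\<Sum>S\<in>?Q. - ((-1) ^ card S))"
  proof (rule sum.reindex_bij_witness[of _ franklin franklin])
    fix S assume S: "S \<in> ?Q"
    show "- ((-1) ^ card (franklin S)) = ((-1) ^ card S :: int)" using f(3)[OF S] by auto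
  qed (use f(1,2) in blast)+
  thus ?thesis by (simp add: sum_negf)
qed

lemma sum_consecutive: "2 * \<Sum>{a..<a + r} + r = r * (2 * a + r :: nat)"
  by (induction r) (simp_all add: algebra_simps)

lemma staircase_sum: "\<Sum>{r + e..<2 * r + e} = k \<longleftrightarrow> 2 * k + r = r * (3 * r + 2 * e :: nat)"
proof -
  have "2 * \<Sum>{r + e..<2 * r + e} + r = r * (2 * (r + e) + r)"
    using sum_consecutive[of "r + e" r] by (simp add: add.commute add.left_commute mult_2)
  also have "2 * (r + e) + r = 3 * r + 2 * e" by simp
  finally show ?thesis by auto
qed

text \<open>Both \<open>r (3 r - 1) / 2\<close> and \<open>r (3 r + 1) / 2\<close> lie below the two numbers of this form that belong to \<open>r + 1\<close>.\<close>

lemma pentagonal_less: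
  fixes r q e f k :: nat
  assumes "2 * k + r = r * (3 * r + 2 * e)" "e \<le> 1" "2 * k + q = q * (3 * q + 2 * f)"
  shows "q \<le> r"
proof (rule ccontr)
  assume "\<not> q \<le> r"
  then obtain d where q: "q = r + 1 + d" by (metis add.assoc add.commute less_natE not_le plus_1_eq_Suc)
  have "r * e \<le> r * 1" using assms(2) by (intro mult_left_mono) simp_all
  hence "2 * k + r \<le> 3 * (r * r) + 2 * r" using assms(1) by (simp add: algebra_simps)
  moreover have "3 * (q * q) \<le> 2 * k + q" using assms(3) by (simp add: algebra_simps)
  moreover have "r * r + 2 * r + 1 + 2 * d \<le> q * q" by (simp add: q algebra_simps)
  ultimately show False using q by linarith
qed

lemma staircase_unique:
  assumes "S \<in> distinct_partitions k" "staircase S" "S' \<in> distinct_partitions k" "staircase S'"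
  shows "S = S'"
proof -
  obtain r e where S: "0 < r" "e \<le> 1" "S = {r + e..<2 * r + e}" using assms(2) unfolding staircase_def by blast
  obtain q f where S': "0 < q" "f \<le> 1" "S' = {q + f..<2 * q + f}" using assms(4) unfolding staircase_def by blast
  have r: "2 * k + r = r * (3 * r + 2 * e)" and q: "2 * k + q = q * (3 * q + 2 * f)"
    using assms(1,3) S S' staircase_sum[of r e k] staircase_sum[of q f k] by (auto simp: distinct_partitions_def)
  have "r = q" using pentagonal_less[OF r S(2) q] pentagonal_less[OF q S'(2) r] by simp
  moreover from this have "e = f" using r q S(1) by simp
  ultimately show ?thesis using S S' by simp
qed

lemma generalized_pentagonal_iff:
  "generalized_pentagonal k \<longleftrightarrow> (\<exists>r e. 0 < r \<and> e \<le> 1 \<and> 2 * k + r = r * (3 * r + 2 * e))"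
proof -
  have 1: "k = (3 * m + 1) * m div 2 \<longleftrightarrow> 2 * k + m = m * (3 * m + 2 * 1)" for m
  proof -
    have "even ((3 * m + 1) * m)" by simp
    thus ?thesis by (auto simp: algebra_simps elim!: evenE)
  qed
  have 0: "k = (3 * m - 1) * m div 2 \<longleftrightarrow> 2 * k + m = m * (3 * m + 2 * 0)" if "1 \<le> m" for m
  proof -
    obtain l where l: "m = Suc l" using \<open>1 \<le> m\<close> by (cases m) auto
    have "even ((3 * m - 1) * m)" by (simp add: l)
    thus ?thesis by (auto simp: l algebra_simps elim!: evenE)
  qed
  show ?thesis
  proof
    assume "generalized_pentagonal k"
    then obtain m where m: "1 \<le> m" "k = (3 * m + 1) * m div 2 \<or> k = (3 * m - 1) * m div 2"
      unfolding generalized_pentagonal_def by blast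
    hence "2 * k + m = m * (3 * m + 2 * 1) \<or> 2 * k + m = m * (3 * m + 2 * 0)" using 0 1 by blast
    thus "\<exists>r e. 0 < r \<and> e \<le> 1 \<and> 2 * k + r = r * (3 * r + 2 * e)"
    proof
      assume "2 * k + m = m * (3 * m + 2 * 1)"
      thus ?thesis using m(1) by (intro exI[of _ m] exI[of _ 1]) simp
    next
      assume "2 * k + m = m * (3 * m + 2 * 0)"
      thus ?thesis using m(1) by (intro exI[of _ m] exI[of _ 0]) simp
    qed
  next
    assume "\<exists>r e. 0 < r \<and> e \<le> 1 \<and> 2 * k + r = r * (3 * r + 2 * e)"
    then obtain r e where re: "0 < r" "e \<le> 1" "2 * k + r = r * (3 * r + 2 * e)" by blast
    have r: "1 \<le> r" using re(1) by simp
    consider "e = 0" | "e = 1" using re(2) by linarith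
    hence "k = (3 * r + 1) * r div 2 \<or> k = (3 * r - 1) * r div 2"
      using 0[OF r] 1[of r] re(3) by cases blast+
    thus "generalized_pentagonal k" unfolding generalized_pentagonal_def using r by blast
  qed
qed

lemma staircase_exists_iff: "(\<exists>S\<in>distinct_partitions k. staircase S) \<longleftrightarrow> generalized_pentagonal k"
proof
  assume "\<exists>S\<in>distinct_partitions k. staircase S"
  then obtain S r e where S: "S \<in> distinct_partitions k" "0 < r" "e \<le> 1" "S = {r + e..<2 * r + e}"
    unfolding staircase_def by blast
  hence "\<Sum>{r + e..<2 * r + e} = k" by (simp add: distinct_partitions_def)
  thus "generalized_pentagonal k" using S(2,3) staircase_sum[of r e k] generalized_pentagonal_iff by blast
next
  assume "generalized_pentagonal k"
  then obtain r e where re: "0 < r" "e \<le> 1" "2 * k + r = r * (3 * r + 2 * e)"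
    using generalized_pentagonal_iff by blast
  have "{r + e..<2 * r + e} \<in> distinct_partitions k"
    using staircase_sum[of r e k] re by (simp add: distinct_partitions_def)
  thus "\<exists>S\<in>distinct_partitions k. staircase S" using re(1,2) unfolding staircase_def by blast
qed

text \<open>All partitions but one cancel in pairs, so the complete alternating sum is the sign of the single staircase.\<close>

lemma recurrence_nonzero_if_pentagonal:
  fixes h :: "nat \<Rightarrow> int"
  assumes k: "0 < k" "k < n" and pent: "generalized_pentagonal k"
    and h: "h 0 = 0" "\<And>t. t < n \<Longrightarrow> h (Suc t) = int (parts_count k t) - h t"
  shows "h n \<noteq> 0"
proof -
  let ?P = "distinct_partitions k"
  obtain S where S: "S \<in> ?P" "staircase S" using pent staircase_exists_iff by blast
  have "{S' \<in> ?P. staircase S'} = {S}" using S staircase_unique by blast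
  hence "?P = insert S {S' \<in> ?P. \<not> staircase S'}" by blast
  moreover have "(\<Sum>S\<in>insert S {S' \<in> ?P. \<not> staircase S'}. (-1) ^ card S :: int) = (-1) ^ card S + 0"
    unfolding signed_count_nonstaircase[OF k(1), symmetric] using S by (intro sum.insert) simp_all
  ultimately have "(\<Sum>S\<in>?P. (-1) ^ card S :: int) = (-1) ^ card S" by simp
  thus ?thesis using signed_count_of_recurrence[OF k(2) h] by auto
qed

text \<open>The defining recursion at the last of the leading \<open>True\<close>s involves a hook-shaped descent word.\<close>

lemma cyc_count_gathered_Suc:
  assumes "k < n" "t < n"
  shows "cyc_count k (replicate (Suc t) True @ replicate (n - Suc t) False)
    = int (parts_count k t) - cyc_count k (replicate t True @ replicate (n - t) False)"
proof -
  have "replicate (Suc t) True @ replicate (n - Suc t) False = replicate t True @ True # replicate (n - Suc t) False"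
    by (simp add: replicate_app_Cons_same)
  moreover have "desc_count k (replicate (n - Suc t) False @ replicate t True) = parts_count k t"
    unfolding parts_count_def using assms by (intro desc_count_hook) simp
  moreover have "Suc (n - Suc t) = n - t" using assms by simp
  ultimately show ?thesis using cyc_count_last_True[of k "replicate t True" "n - Suc t"] by simp
qed

lemma cyc_count_gathered:
  assumes k: "0 < k" "k < n" and pent: "\<not> generalized_pentagonal k" and t: "t \<le> n"
  shows "cyc_count k (replicate t True @ replicate (n - t) False)
    = int (card {S \<in> distinct_partitions k. card S < t \<and> t \<le> card (franklin S)})"
proof (rule alternating_count_of_pairing[OF k(1) _ _ _ t])
  show "\<not> staircase S" if "S \<in> distinct_partitions k" for S
    using that pent staircase_exists_iff[of k] by blast
qed (use cyc_count_gathered_Suc[OF k(2)] in simp_all)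

lemma cyc_count_nonneg:
  assumes k: "0 < k" "k < length b" and pent: "\<not> generalized_pentagonal k"
  shows "0 \<le> cyc_count k b"
proof (cases "True \<in> set b")
  case True
  define t where "t = length (filter id b)"
  have len: "length b = t + length (filter Not b)" using sum_length_filter_compl[of id b] by (simp add: t_def)
  have "0 \<le> cyc_count k (replicate t True @ replicate (length b - t) False)"
    using cyc_count_gathered[OF k pent, of t] len by simp
  also have "\<dots> \<le> cyc_count k b"
    using cyc_count_ge_gathered[OF k(2) True] len by (simp flip: t_def)
  finally show ?thesis .
next
  case False
  hence "b = replicate (length b) False" by (metis (full_types) replicate_length_same)
  hence "cyc_count k b = 0" by (metis cyc_count_all_False)
  thus ?thesis by simp
qed

text \<open>The gathered count at \<open>t = n\<close> counts partitions whose partner has at least \<open>n\<close> parts, but a partition of \<open>k < n\<close>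
cannot have that many.\<close>

lemma cyc_count_all_True:
  assumes k: "0 < k" "k < n" and pent: "\<not> generalized_pentagonal k"
  shows "cyc_count k (replicate n True) = 0"
proof -
  have "card (franklin S) < n" if "S \<in> distinct_partitions k" for S
    using franklin_involution(1)[OF k(1), of S] card_distinct_partition_le[of "franklin S" k]
      that pent staircase_exists_iff[of k] k(2) by fastforce
  hence "{S \<in> distinct_partitions k. card S < n \<and> n \<le> card (franklin S)} = {}" by fastforce
  thus ?thesis using cyc_count_gathered[OF k pent order_refl] by simp
qed

section \<open>Cyclic descent extensions as fibre counts\<close>

text \<open>The conditions satisfied by the sizes \<open>N J\<close> of the fibres of \<open>cDes\<close>.\<close>

definition cyclic_fibre_counts :: "nat \<Rightarrow> 'a set \<Rightarrow> ('a \<Rightarrow> nat set) \<Rightarrow> (nat set \<Rightarrow> nat) \<Rightarrow> bool" where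
  "cyclic_fibre_counts n T D N \<longleftrightarrow>
     (\<forall>J\<subseteq>{1..n}. N (cyc_shift n J) = N J) \<and> N {} = 0 \<and> N {1..n} = 0 \<and>
     (\<forall>J\<subseteq>{1..n - 1}. N J + N (insert n J) = card {t \<in> T. D t = J})"

lemma inj_on_cyc_step: "inj_on (\<lambda>i. i mod n + 1) {1..n :: nat}"
proof (rule inj_onI)
  fix i j assume i: "i \<in> {1..n}" and j: "j \<in> {1..n}" and eq: "i mod n + 1 = j mod n + 1"
  have mod: "x mod n = (if x = n then 0 else x)" if "x \<in> {1..n}" for x using that by auto
  show "i = j" using eq mod[OF i] mod[OF j] i j by (auto split: if_splits)
qed

lemma cyc_shift_subset: "J \<subseteq> {1..n} \<Longrightarrow> cyc_shift n J \<subseteq> {1..n}"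
  by (auto simp: cyc_shift_def Suc_le_eq)

lemma cyc_shift_inject: "I \<subseteq> {1..n} \<Longrightarrow> J \<subseteq> {1..n} \<Longrightarrow> cyc_shift n I = cyc_shift n J \<Longrightarrow> I = J"
  unfolding cyc_shift_def by (rule inj_on_image_eq_iff[OF inj_on_cyc_step, THEN iffD1])

text \<open>The bijection \<open>p\<close> maps the fibre over \<open>J\<close> onto the fibre over its shift, because the shift is injective; and \<open>D t = J\<close>
leaves only \<open>J\<close> and \<open>insert n J\<close> as values of \<open>cDes t\<close>.\<close>

lemma cyclic_fibre_counts_of_extension:
  assumes T: "finite T" and n: "0 < n" and ext: "cyclic_descent_extension n T D cDes p"
  shows "cyclic_fibre_counts n T D (\<lambda>J. card {t \<in> T. cDes t = J})"
proof -
  have sub: "cDes t \<subseteq> {1..n}" and D: "cDes t \<inter> {1..n - 1} = D t"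
    and shift: "cDes (p t) = cyc_shift n (cDes t)" and ne: "cDes t \<noteq> {}" "cDes t \<noteq> {1..n}" if "t \<in> T" for t
    using ext that by (auto simp: cyclic_descent_extension_def)
  have p: "bij_betw p T T" using ext by (simp add: cyclic_descent_extension_def)
  have "card {t \<in> T. cDes t = cyc_shift n J} = card {t \<in> T. cDes t = J}" if J: "J \<subseteq> {1..n}" for J
  proof -
    have "card {t \<in> T. cDes t = cyc_shift n J} = card {t \<in> T. cDes (p t) = cyc_shift n J}"
      by (rule card_filter_bij[OF p])
    moreover have "cDes (p t) = cyc_shift n J \<longleftrightarrow> cDes t = J" if "t \<in> T" for t
      unfolding shift[OF that] using cyc_shift_inject[OF sub[OF that] J] by blast
    hence "{t \<in> T. cDes (p t) = cyc_shift n J} = {t \<in> T. cDes t = J}" by blast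
    ultimately show ?thesis by (simp only:)
  qed
  moreover have "card {t \<in> T. cDes t = J} + card {t \<in> T. cDes t = insert n J} = card {t \<in> T. D t = J}"
    if J: "J \<subseteq> {1..n - 1}" for J
  proof -
    have notin: "n \<notin> J" using J n by fastforce
    have "n \<notin> {1..n - 1}" "{1..n} = insert n {1..n - 1}" using n by auto
    note n' = this
    have "D t = J \<longleftrightarrow> cDes t = J \<or> cDes t = insert n J" if t: "t \<in> T" for t
    proof
      assume "D t = J"
      moreover have "cDes t \<subseteq> insert n {1..n - 1}" using sub[OF t] n'(2) by simp
      ultimately show "cDes t = J \<or> cDes t = insert n J" using D[OF t] by blast
    next
      assume "cDes t = J \<or> cDes t = insert n J"
      hence "cDes t \<inter> {1..n - 1} = J \<inter> {1..n - 1}"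
        by (elim disjE) (simp_all only: Int_insert_left_if0[OF n'(1)])
      hence "cDes t \<inter> {1..n - 1} = J" using J by (simp only: inf_absorb1)
      thus "D t = J" using D[OF t] by simp
    qed
    hence "{t \<in> T. D t = J} = {t \<in> T. cDes t = J} \<union> {t \<in> T. cDes t = insert n J}" by blast
    moreover have "J \<noteq> insert n J" using notin by blast
    hence "{t \<in> T. cDes t = J} \<inter> {t \<in> T. cDes t = insert n J} = {}" by blast
    ultimately show ?thesis using T by (simp add: card_Un_disjoint)
  qed
  moreover have "{t \<in> T. cDes t = {}} = {}" "{t \<in> T. cDes t = {1..n}} = {}" using ne by blast+
  hence "card {t \<in> T. cDes t = {}} = 0" "card {t \<in> T. cDes t = {1..n}} = 0" by (simp_all only: card.empty)
  ultimately show ?thesis unfolding cyclic_fibre_counts_def by blast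
qed

text \<open>Within each fibre of \<open>D\<close> choose a subset \<open>U\<close> of the prescribed size on which \<open>n\<close> is declared a cyclic
descent. Then the fibres of \<open>cDes\<close> have sizes \<open>N J\<close>, shift invariance provides bijections between the fibres
over \<open>J\<close> and over its shift, and these combine to \<open>p\<close>.\<close>

lemma extension_of_cyclic_fibre_counts:
  assumes T: "finite T" and n: "0 < n" and D: "D \<in> T \<rightarrow> Pow {1..n - 1}" and N: "cyclic_fibre_counts n T D N"
  shows "\<exists>cDes p. cyclic_descent_extension n T D cDes p"
proof -
  have shiftN: "N (cyc_shift n J) = N J" if "J \<subseteq> {1..n}" for J using N that by (simp add: cyclic_fibre_counts_def)
  have N0: "N {} = 0" "N {1..n} = 0" using N by (simp_all add: cyclic_fibre_counts_def)
  have fibre: "N J + N (insert n J) = card {t \<in> T. D t = J}" if "J \<subseteq> {1..n - 1}" for J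
    using N that by (simp add: cyclic_fibre_counts_def)
  have D': "D t \<subseteq> {1..n - 1}" if "t \<in> T" for t using D that by auto
  have n': "n \<notin> {1..n - 1}" "{1..n} = insert n {1..n - 1}" using n by auto
  have ex_U: "\<exists>U. U \<subseteq> {t \<in> T. D t = J} \<and> card U = N (insert n J)" if J: "J \<subseteq> {1..n - 1}" for J
  proof -
    have "N (insert n J) \<le> card {t \<in> T. D t = J}" using fibre[OF J] by simp
    then obtain U where "U \<subseteq> {t \<in> T. D t = J}" "card U = N (insert n J)"
      by (rule obtain_subset_with_card_n)
    thus ?thesis by blast
  qed
  define U where "U J = (SOME U. U \<subseteq> {t \<in> T. D t = J} \<and> card U = N (insert n J))" for J
  have U: "U J \<subseteq> {t \<in> T. D t = J}" "card (U J) = N (insert n J)" if "J \<subseteq> {1..n - 1}" for J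
    using someI_ex[OF ex_U[OF that]] unfolding U_def by blast+
  define cDes where "cDes t = (if t \<in> U (D t) then insert n (D t) else D t)" for t
  have sub: "cDes t \<subseteq> {1..n}" and cD: "cDes t \<inter> {1..n - 1} = D t" if "t \<in> T" for t
    using D'[OF that] n' by (auto simp: cDes_def)
  have count: "card {t \<in> T. cDes t = J} = N J" if J: "J \<subseteq> {1..n}" for J
  proof (cases "n \<in> J")
    case True
    define I where "I = J - {n}"
    have I: "I \<subseteq> {1..n - 1}" "J = insert n I" "n \<notin> I" using J n' True by (auto simp: I_def)
    have "{t \<in> T. cDes t = J} = U I"
    proof (intro equalityI subsetI)
      fix t assume "t \<in> {t \<in> T. cDes t = J}"
      hence t: "t \<in> T" "cDes t = insert n I" using I by auto
      hence "D t = I" using cD[OF t(1)] I n'(1) by auto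
      moreover have "t \<in> U (D t)" using t(2) D'[OF t(1)] n'(1) by (auto simp: cDes_def split: if_splits)
      ultimately show "t \<in> U I" by simp
    next
      fix t assume "t \<in> U I"
      thus "t \<in> {t \<in> T. cDes t = J}" using U(1)[OF I(1)] I(2) by (auto simp: cDes_def)
    qed
    thus ?thesis using U(2)[OF I(1)] I(2) by simp
  next
    case False
    hence J': "J \<subseteq> {1..n - 1}" using J n' by auto
    have "{t \<in> T. cDes t = J} = {t \<in> T. D t = J} - U J"
      using False by (auto simp: cDes_def split: if_splits)
    moreover have "card ({t \<in> T. D t = J} - U J) = card {t \<in> T. D t = J} - card (U J)"
      using U(1)[OF J'] T by (intro card_Diff_subset) (auto intro: finite_subset)
    ultimately show ?thesis using U(2)[OF J'] fibre[OF J'] by simp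
  qed
  have ex_q: "\<exists>q. bij_betw q {t \<in> T. cDes t = J} {t \<in> T. cDes t = cyc_shift n J}" if J: "J \<subseteq> {1..n}" for J
    using T count[OF J] count[OF cyc_shift_subset[OF J]] shiftN[OF J]
    by (intro finite_same_card_bij) simp_all
  define q where "q J = (SOME q. bij_betw q {t \<in> T. cDes t = J} {t \<in> T. cDes t = cyc_shift n J})" for J
  have q: "bij_betw (q J) {t \<in> T. cDes t = J} {t \<in> T. cDes t = cyc_shift n J}" if "J \<subseteq> {1..n}" for J
    using someI_ex[OF ex_q[OF that]] unfolding q_def .
  define p where "p t = q (cDes t) t" for t
  have p: "p t \<in> T" "cDes (p t) = cyc_shift n (cDes t)" if "t \<in> T" for t
    using bij_betwE[OF q[OF sub[OF that]]] that by (auto simp: p_def)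
  have "inj_on p T"
  proof (rule inj_onI)
    fix s t assume s: "s \<in> T" and t: "t \<in> T" and eq: "p s = p t"
    have same: "cDes s = cDes t"
      using cyc_shift_inject[OF sub[OF s] sub[OF t]] p(2)[OF s] p(2)[OF t] eq by simp
    hence "q (cDes t) s = q (cDes t) t" using eq by (simp add: p_def)
    thus "s = t" using inj_onD[OF bij_betw_imp_inj_on[OF q[OF sub[OF t]]]] s t same by simp
  qed
  moreover have "p ` T \<subseteq> T" using p(1) by blast
  ultimately have "bij_betw p T T" using endo_inj_surj[OF T] by (simp add: bij_betw_def)
  moreover have "{} \<subset> cDes t \<and> cDes t \<subset> {1..n}" if t: "t \<in> T" for t
  proof -
    have "card {s \<in> T. cDes s = cDes t} \<noteq> 0" using T t by auto
    hence "N (cDes t) \<noteq> 0" using count[OF sub[OF t]] by simp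
    hence "cDes t \<noteq> {}" "cDes t \<noteq> {1..n}" using N0 by metis+
    thus ?thesis using sub[OF t] by blast
  qed
  ultimately have "cyclic_descent_extension n T D cDes p"
    unfolding cyclic_descent_extension_def using sub cD p(2) by blast
  thus ?thesis by blast
qed

text \<open>One-line notation, with values lowered by one. The map is injective, and both sides have \<open>n!\<close> elements.\<close>

lemma word_bij: "bij_betw (\<lambda>\<pi>. map (\<lambda>i. \<pi> i - 1) [1..<Suc n]) {\<pi>. \<pi> permutes {1..n}} (perm_lists n)"
  (is "bij_betw ?w ?P _")
proof -
  have range: "\<pi> i \<in> {1..n}" if "\<pi> permutes {1..n}" "i \<in> {1..n}" for \<pi> i
    using permutes_in_image[OF that(1), of i] that(2) by simp
  have set_upt': "set [1..<Suc n] = {1..n}" by auto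
  have inj: "inj_on ?w ?P"
  proof (rule inj_onI)
    fix \<pi> \<sigma> assume \<pi>: "\<pi> \<in> ?P" and \<sigma>: "\<sigma> \<in> ?P" and eq: "?w \<pi> = ?w \<sigma>"
    show "\<pi> = \<sigma>"
    proof
      fix i show "\<pi> i = \<sigma> i"
      proof (cases "i \<in> {1..n}")
        case True
        hence "\<pi> i - 1 = \<sigma> i - 1" using eq unfolding map_eq_conv set_upt' by blast
        moreover have "1 \<le> \<pi> i" "1 \<le> \<sigma> i" using range[of \<pi> i] range[of \<sigma> i] \<pi> \<sigma> True by simp_all
        ultimately show ?thesis by linarith
      next
        case False
        thus ?thesis using \<pi> \<sigma> by (simp add: permutes_not_in)
      qed
    qed
  qed
  have sub: "?w ` ?P \<subseteq> perm_lists n"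
  proof (rule image_subsetI)
    fix \<pi> assume "\<pi> \<in> ?P"
    hence \<pi>: "\<pi> permutes {1..n}" by simp
    have "inj_on (\<lambda>i. \<pi> i - 1) {1..n}"
    proof (rule inj_onI)
      fix i j assume i: "i \<in> {1..n}" and j: "j \<in> {1..n}" and "\<pi> i - 1 = \<pi> j - 1"
      moreover have "1 \<le> \<pi> i" "1 \<le> \<pi> j" using range[OF \<pi> i] range[OF \<pi> j] by simp_all
      ultimately have "\<pi> i = \<pi> j" by linarith
      thus "i = j" using permutes_inj[OF \<pi>] by (simp add: inj_eq)
    qed
    moreover have "(\<lambda>i. \<pi> i - 1) ` {1..n} = (\<lambda>i. i - 1) ` \<pi> ` {1..n}" by (simp add: image_image)
    moreover have "(\<lambda>i. i - 1) ` {1..n} = {..<n}"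
    proof (intro equalityI subsetI)
      fix x assume "x \<in> {..<n}"
      thus "x \<in> (\<lambda>i. i - 1) ` {1..n}" by (intro image_eqI[of _ _ "Suc x"]) simp_all
    qed auto
    ultimately show "?w \<pi> \<in> perm_lists n"
      unfolding perm_lists_eq mem_Collect_eq distinct_map set_map set_upt' permutes_image[OF \<pi>] by simp
  qed
  have "card (perm_lists n) = fact n" by (simp add: perm_lists_def)
  moreover have "card (?w ` ?P) = fact n" using card_image[OF inj] card_permutations[of "{1..n}" n] by simp
  ultimately have "?w ` ?P = perm_lists n" using card_subset_eq[OF finite_perm_lists sub] by simp
  thus ?thesis using inj by (simp add: bij_betw_def)
qed

lemma inversions_map_upt:
  "inversions (map f [1..<Suc n]) = card {(i, j). i \<in> {1..n} \<and> j \<in> {1..n} \<and> i < j \<and> f j < f i}"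
proof (induction n)
  case (Suc n)
  let ?A = "\<lambda>n. {(i, j). i \<in> {1..n} \<and> j \<in> {1..n} \<and> i < j \<and> f j < f i}"
  let ?B = "{i \<in> {1..n}. f (Suc n) < f i}"
  have fin: "finite (?A n)" by (rule finite_subset[of _ "{1..n} \<times> {1..n}"]) auto
  have "?A (Suc n) = ?A n \<union> (\<lambda>i. (i, Suc n)) ` ?B" by (auto simp: le_Suc_eq)
  moreover have "?A n \<inter> (\<lambda>i. (i, Suc n)) ` ?B = {}" by auto
  ultimately have "card (?A (Suc n)) = card (?A n) + card ((\<lambda>i. (i, Suc n)) ` ?B)"
    using fin by (simp add: card_Un_disjoint)
  also have "card ((\<lambda>i. (i, Suc n)) ` ?B) = card ?B" by (rule card_image) (simp add: inj_on_def)
  also have "card ?B = length (filter (\<lambda>y. f (Suc n) < y) (map f [1..<Suc n]))"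
  proof -
    have "length (filter (\<lambda>y. f (Suc n) < y) (map f [1..<Suc n])) = length (filter (\<lambda>i. f (Suc n) < f i) [1..<Suc n])"
      by (simp only: filter_map length_map o_def)
    also have "\<dots> = card ({i. f (Suc n) < f i} \<inter> set [1..<Suc n])"
      by (rule distinct_length_filter) (rule distinct_upt)
    also have "{i. f (Suc n) < f i} \<inter> set [1..<Suc n] = ?B" by auto
    finally show ?thesis by simp
  qed
  finally have "card (?A (Suc n)) = card (?A n) + length (filter (\<lambda>y. f (Suc n) < y) (map f [1..<Suc n]))" .
  moreover have "map f [1..<Suc (Suc n)] = map f [1..<Suc n] @ [f (Suc n)]" by simp
  ultimately show ?case using Suc.IH by (simp only: inversions_append1)
qed simp

lemma descents_map_upt: "descents (map f [1..<Suc n]) = map (\<lambda>i. f (i + 1) < f i) [1..<n]"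
proof (induction n)
  case (Suc n)
  show ?case
  proof (cases "n = 0")
    case False
    have "map f [1..<Suc (Suc n)] = map f [1..<Suc n] @ [f (Suc n)]" by simp
    moreover have "descents (map f [1..<Suc n] @ [f (Suc n)])
        = descents (map f [1..<Suc n]) @ [f (Suc n) < last (map f [1..<Suc n])]"
      using False by (intro descents_append1) simp
    moreover have "last (map f [1..<Suc n]) = f n" using False by simp
    moreover have "map (\<lambda>i. f (i + 1) < f i) [1..<Suc n] = map (\<lambda>i. f (i + 1) < f i) [1..<n] @ [f (Suc n) < f n]"
      using False by simp
    ultimately show ?thesis using Suc.IH by (simp only:)
  qed simp
qed simp

lemma card_perms_with_inv_Des:
  assumes n: "0 < n" and J: "J \<subseteq> {1..n - 1}"
  shows "card {\<pi> \<in> perms_with_inv n k. Des n \<pi> = J} = desc_count k (map (\<lambda>i. i \<in> J) [1..<n])"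
proof -
  let ?w = "\<lambda>\<pi>. map (\<lambda>i. \<pi> i - 1) [1..<Suc n]" and ?J = "map (\<lambda>i. i \<in> J) [1..<n]"
  have stats: "inv_number n \<pi> = inversions (?w \<pi>) \<and> (Des n \<pi> = J \<longleftrightarrow> descents (?w \<pi>) = ?J)" if \<pi>: "\<pi> permutes {1..n}" for \<pi>
  proof
    have less: "\<pi> j - 1 < \<pi> i - 1 \<longleftrightarrow> \<pi> j < \<pi> i" if "i \<in> {1..n}" "j \<in> {1..n}" for i j
      using permutes_in_image[OF \<pi>, of i] permutes_in_image[OF \<pi>, of j] that by auto
    show "inv_number n \<pi> = inversions (?w \<pi>)"
      unfolding inversions_map_upt inv_number_def by (rule arg_cong[of _ _ card]) (use less in auto)
    have "descents (?w \<pi>) = ?J \<longleftrightarrow> (\<forall>i\<in>{1..<n}. (\<pi> (i + 1) - 1 < \<pi> i - 1) = (i \<in> J))"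
      unfolding descents_map_upt map_eq_conv by simp
    also have "\<dots> \<longleftrightarrow> (\<forall>i\<in>{1..<n}. (\<pi> (i + 1) < \<pi> i) = (i \<in> J))"
      using less by (intro ball_cong refl) simp
    also have "\<dots> \<longleftrightarrow> (\<forall>i\<in>{1..n - 1}. i \<in> Des n \<pi> \<longleftrightarrow> i \<in> J)"
      using n by (auto simp: Des_def)
    also have "\<dots> \<longleftrightarrow> Des n \<pi> = J"
    proof -
      have "Des n \<pi> \<subseteq> {1..n - 1}" by (auto simp: Des_def)
      thus ?thesis using J by blast
    qed
    finally show "Des n \<pi> = J \<longleftrightarrow> descents (?w \<pi>) = ?J" by blast
  qed
  have "\<pi> \<in> perms_with_inv n k \<and> Des n \<pi> = J
      \<longleftrightarrow> \<pi> \<in> {\<pi>. \<pi> permutes {1..n}} \<and> descents (?w \<pi>) = ?J \<and> inversions (?w \<pi>) = k" for \<pi>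
    unfolding perms_with_inv_def mem_Collect_eq using stats[of \<pi>] by metis
  hence "{\<pi> \<in> perms_with_inv n k. Des n \<pi> = J}
    = {\<pi> \<in> {\<pi>. \<pi> permutes {1..n}}. descents (?w \<pi>) = ?J \<and> inversions (?w \<pi>) = k}"
    by blast
  hence "card {\<pi> \<in> perms_with_inv n k. Des n \<pi> = J} = card {w \<in> perm_lists n. descents w = ?J \<and> inversions w = k}"
    by (simp only: card_filter_bij[OF word_bij])
  moreover have "Suc (length ?J) = n" using n by simp
  ultimately show ?thesis unfolding desc_count_def perms_with_def by (simp only:)
qed

lemma finite_perms_with_inv: "finite (perms_with_inv n k)"
  by (rule finite_subset[OF _ finite_permutations[of "{1..n}"]]) (auto simp: perms_with_inv_def)

text \<open>The cyclic shift of a subset is a rotation of its indicator word.\<close>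

lemma indicator_cyc_shift:
  assumes n: "0 < n" and J: "J \<subseteq> {1..n}"
  shows "map (\<lambda>i. i \<in> cyc_shift n J) [1..<Suc n] = (n \<in> J) # map (\<lambda>i. i \<in> J) [1..<n]"
proof -
  have step: "Suc i \<in> cyc_shift n J \<longleftrightarrow> i \<in> J" if i: "1 \<le> i" "i < n" for i
  proof
    assume "Suc i \<in> cyc_shift n J"
    then obtain j where j: "j \<in> J" "j mod n = i" by (auto simp: cyc_shift_def)
    hence "j \<noteq> n" "j \<le> n" using i J by auto
    thus "i \<in> J" using j by simp
  next
    assume "i \<in> J"
    thus "Suc i \<in> cyc_shift n J" using i by (auto simp: cyc_shift_def intro: image_eqI[of _ _ i])
  qed
  have one: "1 \<in> cyc_shift n J \<longleftrightarrow> n \<in> J"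
  proof
    assume "1 \<in> cyc_shift n J"
    then obtain j where j: "j \<in> J" "j mod n = 0" by (auto simp: cyc_shift_def)
    hence "1 \<le> j" "j \<le> n" using J by auto
    thus "n \<in> J" using j by (metis le_neq_implies_less mod_less not_one_le_zero)
  next
    assume "n \<in> J"
    thus "1 \<in> cyc_shift n J" by (auto simp: cyc_shift_def intro: image_eqI[of _ _ n])
  qed
  have "[1..<Suc n] = 1 # map Suc [1..<n]" using n by (simp add: upt_conv_Cons map_Suc_upt del: upt_Suc)
  hence "map (\<lambda>i. i \<in> cyc_shift n J) [1..<Suc n] = (1 \<in> cyc_shift n J) # map (\<lambda>i. Suc i \<in> cyc_shift n J) [1..<n]"
    by simp
  also have "map (\<lambda>i. Suc i \<in> cyc_shift n J) [1..<n] = map (\<lambda>i. i \<in> J) [1..<n]"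
    using step by (intro map_cong refl) simp
  finally show ?thesis using one by simp
qed

lemma cyclic_fibre_counts_of_cyc_count:
  assumes k: "0 < k" "k < n" and pent: "\<not> generalized_pentagonal k"
  shows "cyclic_fibre_counts n (perms_with_inv n k) (Des n) (\<lambda>J. nat (cyc_count k (map (\<lambda>i. i \<in> J) [1..<Suc n])))"
  unfolding cyclic_fibre_counts_def
proof (intro conjI allI impI)
  have n: "0 < n" using k by simp
  let ?b = "\<lambda>J. map (\<lambda>i. i \<in> J) [1..<Suc n]"
  have last: "?b J = map (\<lambda>i. i \<in> J) [1..<n] @ [n \<in> J]" for J using n by simp
  show "nat (cyc_count k (?b (cyc_shift n J))) = nat (cyc_count k (?b J))" if J: "J \<subseteq> {1..n}" for J
    unfolding indicator_cyc_shift[OF n J] last cyc_count_rotate by (rule refl)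
  have "?b {} = replicate n False" by (simp add: map_replicate_const del: upt_Suc)
  thus "nat (cyc_count k (?b {})) = 0" by (simp only: cyc_count_all_False nat_0)
  have "?b {1..n} = map (\<lambda>_. True) [1..<Suc n]" by (intro map_cong refl) auto
  also have "\<dots> = replicate n True" by (simp add: map_replicate_const del: upt_Suc)
  finally show "nat (cyc_count k (?b {1..n})) = 0" using cyc_count_all_True[OF k pent] by (simp only: nat_0)
  fix J assume J: "J \<subseteq> {1..n - 1}"
  let ?l = "map (\<lambda>i. i \<in> J) [1..<n]"
  have "map (\<lambda>i. i \<in> insert n J) [1..<n] = ?l" by (intro map_cong refl) auto
  hence ins: "?b (insert n J) = ?l @ [True]" unfolding last by simp
  have "n \<notin> J" using J n by auto
  hence b: "?b J = ?l @ [False]" unfolding last by simp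
  have nonneg: "0 \<le> cyc_count k (?l @ [x])" for x
  proof (rule cyc_count_nonneg[OF k(1) _ pent])
    show "k < length (?l @ [x])" using k(2) by simp
  qed
  have "cyc_count k (?l @ [True]) = int (desc_count k ?l) - cyc_count k (?l @ [False])" by (rule cyc_count_True)
  hence "nat (cyc_count k (?l @ [False])) + nat (cyc_count k (?l @ [True])) = desc_count k ?l"
    using nonneg[of True] nonneg[of False] by linarith
  thus "nat (cyc_count k (?b J)) + nat (cyc_count k (?b (insert n J))) = card {\<pi> \<in> perms_with_inv n k. Des n \<pi> = J}"
    unfolding b ins card_perms_with_inv_Des[OF n J] .
qed

text \<open>On the final intervals \<open>{n - t<..n}\<close> any fibre counts satisfy the recursion of the gathered cyclic count, since
\<open>{n - t..<n}\<close> is shifted to \<open>{n - t<..n}\<close> and has a hook-shaped indicator word. So the value at \<open>{1..n}\<close> is forced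
to be nonzero.\<close>

lemma no_cyclic_fibre_counts_if_pentagonal:
  assumes k: "0 < k" "k < n" and pent: "generalized_pentagonal k"
  shows "\<not> cyclic_fibre_counts n (perms_with_inv n k) (Des n) N"
proof
  assume N: "cyclic_fibre_counts n (perms_with_inv n k) (Des n) N"
  have n: "0 < n" using k by simp
  define h where "h t = int (N {n - t<..n})" for t
  have "h (Suc t) = int (parts_count k t) - h t" if t: "t < n" for t
  proof -
    let ?J = "{n - t..<n}"
    have J: "?J \<subseteq> {1..n - 1}" "?J \<subseteq> {1..n}" using t by auto
    have "cyc_shift n ?J = Suc ` ?J" unfolding cyc_shift_def by (intro image_cong refl) simp
    also have "\<dots> = {n - t<..n}" by (auto simp: image_Suc_atLeastLessThan)
    finally have "cyc_shift n ?J = {n - t<..n}" .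
    moreover have "N (cyc_shift n ?J) = N ?J" using N J(2) unfolding cyclic_fibre_counts_def by blast
    ultimately have "N ?J = N {n - t<..n}" by (simp only:)
    moreover have "insert n ?J = {n - Suc t<..n}" using t by auto
    moreover have "N ?J + N (insert n ?J) = desc_count k (map (\<lambda>i. i \<in> ?J) [1..<n])"
      unfolding card_perms_with_inv_Des[OF n J(1), symmetric] using N J(1) unfolding cyclic_fibre_counts_def by blast
    moreover have "map (\<lambda>i. i \<in> ?J) [1..<n] = replicate (n - Suc t) False @ replicate t True"
    proof -
      have "[1..<n] = [1..<n - t] @ [n - t..<n]" using upt_add_eq_append[of 1 "n - t" t] t by simp
      moreover have "map (\<lambda>i. i \<in> ?J) [1..<n - t] = map (\<lambda>_. False) [1..<n - t]" by (intro map_cong refl) auto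
      moreover have "map (\<lambda>i. i \<in> ?J) [n - t..<n] = map (\<lambda>_. True) [n - t..<n]" by (intro map_cong refl) auto
      ultimately show ?thesis using t by (simp add: map_replicate_const)
    qed
    moreover have "desc_count k (replicate (n - Suc t) False @ replicate t True) = parts_count k t"
      unfolding parts_count_def using k t by (intro desc_count_hook) simp
    ultimately show ?thesis by (simp add: h_def)
  qed
  moreover have "h 0 = 0" using N by (simp add: h_def cyclic_fibre_counts_def)
  moreover have "{0<..n} = {1..n}" by auto
  hence "h n = 0" using N by (simp add: h_def cyclic_fibre_counts_def)
  ultimately show False using recurrence_nonzero_if_pentagonal[OF k pent] by blast
qed

theorem theorem4p3p11:
  fixes n k :: nat
  assumes "0 < k" and "k < n"
  shows "(\<exists>cDes p. cyclic_descent_extension n (perms_with_inv n k) (Des n) cDes p)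
         \<longleftrightarrow> \<not> generalized_pentagonal k"
proof -
  have n: "0 < n" using assms by simp
  have Des: "Des n \<in> perms_with_inv n k \<rightarrow> Pow {1..n - 1}" by (auto simp: Des_def)
  show ?thesis
  proof
    assume "\<exists>cDes p. cyclic_descent_extension n (perms_with_inv n k) (Des n) cDes p"
    then obtain cDes p where "cyclic_descent_extension n (perms_with_inv n k) (Des n) cDes p" by blast
    from cyclic_fibre_counts_of_extension[OF finite_perms_with_inv n this]
    show "\<not> generalized_pentagonal k" using no_cyclic_fibre_counts_if_pentagonal[OF assms] by blast
  next
    assume "\<not> generalized_pentagonal k"
    from cyclic_fibre_counts_of_cyc_count[OF assms this]
    show "\<exists>cDes p. cyclic_descent_extension n (perms_with_inv n k) (Des n) cDes p"
      by (rule extension_of_cyclic_fibre_counts[OF finite_perms_with_inv n Des])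
  qed
qed

end
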